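(* Let $U/K$ be a compact symmetric space given by commuting involutions $\tau,\sigma$ of a complex semi-simple Lie group $G$ as in the context, with Lie algebra decomposition $\mathcal{U}=\mathcal{K}+\mathcal{P}$. Let $(a,u,v):\mathbb{R}^2\to\mathcal{U}\times\mathcal{U}\times\mathcal{U}$ be a solution of the $-1$ flow equation associated to $U$, i.e. $a_\eta=0$, $u_\eta=[a,v]$, $v_\xi=-[u,v]$, let $E(\xi,\eta,\lambda)$ be the trivialization of its Lax pair, and let $s=E(\cdot,\cdot,-1)E(\cdot,\cdot,1)^{-1}$ be the corresponding wave map into $U$. If $a$ and $v$ take values in $\mathcal{P}$ and $u$ takes values in $\mathcal{K}$, then the image of $s$ lies in $M_\sigma=\{g\sigma(g)^{-1}: g\in U\}$, so that $s$ is a wave map into the symmetric space $U/K$.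
   Context: $G$ is a complex semi-simple Lie group with Lie algebra $\mathcal{G}$; $\tau,\sigma$ are involutions (group automorphisms of order two) of $G$ with $\sigma\tau=\tau\sigma$, whose differentials at the identity $\tau_*,\sigma_*$ are respectively conjugate linear and complex linear on $\mathcal{G}$. $U$ is the fixed point set of $\tau$ in $G$, assumed compact, with Lie algebra $\mathcal{U}$; $\sigma(U)\subset U$; $K$ is the fixed point set of $\sigma$ in $U$, with Lie algebra $\mathcal{K}$ (the $+1$ eigenspace of $\sigma_*$ on $\mathcal{U}$), and $\mathcal{P}$ is the $-1$ eigenspace of $\sigma_*$ on $\mathcal{U}$. $M_\sigma$ is a totally geodesic submanifold of $U$ isometric to the symmetric space $U/K$ (the Cartan embedding), so wave maps into $U$ with image in $M_\sigma$ are wave maps into $U/K$. Coordinates on $\mathbb{R}^{1,1}$: $\xi=\frac{x+t}{2}$, $\eta=\frac{x-t}{2}$. A wave map $s:\mathbb{R}^{1,1}\to U$ is a smooth map with $(s^{-1}s_t)_t=(s^{-1}s_x)_x$. The trivialization $E(\xi,\eta,\lambda)\in G$, $\lambda\in\mathbb{C}\setminus\{0\}$, of the Lax pair $\theta_\lambda=(a\lambda+u)d\xi+\lambda^{-1}v\,d\eta$ is the solution of $E^{-1}E_\xi=a\lambda+u$, $E^{-1}E_\eta=\lambda^{-1}v$, $E(0,0,\lambda)=e$. *)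

theory Defs
  imports "HOL-Analysis.Analysis" "HOL-Algebra.Coset"
begin

section \<open>Smooth and holomorphic maps between open sets\<close>

text \<open>Only meaningful for open \<open>S\<close> in a finite-dimensional space, where continuity of all
  iterated directional derivatives is the usual notion of class \<open>C\<^sup>k\<close>.\<close>

fun C_k_on :: "nat \<Rightarrow> 'a::real_normed_vector set \<Rightarrow> ('a \<Rightarrow> 'b::real_normed_vector) \<Rightarrow> bool" where
  "C_k_on 0 S f \<longleftrightarrow> continuous_on S f"
| "C_k_on (Suc k) S f \<longleftrightarrow> (\<forall>x\<in>S. f differentiable (at x)) \<and>
     (\<forall>v. C_k_on k S (\<lambda>x. frechet_derivative f (at x) v))"

definition smooth_on :: "'a::real_normed_vector set \<Rightarrow> ('a \<Rightarrow> 'b::real_normed_vector) \<Rightarrow> bool" where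
  "smooth_on S f \<longleftrightarrow> (\<forall>k. C_k_on k S f)"

text \<open>Holomorphy in several variables, as smoothness together with the Cauchy-Riemann equations
  \<open>df \<circ> J = J' \<circ> df\<close>, where \<open>J\<close>, \<open>J'\<close> are the multiplications by the imaginary unit on the source
  and target; the argument \<open>J\<close> lets the same definition serve for products.\<close>

definition holo_on ::
  "('a \<Rightarrow> 'a) \<Rightarrow> ('b \<Rightarrow> 'b) \<Rightarrow> 'a::real_normed_vector set \<Rightarrow> ('a \<Rightarrow> 'b::real_normed_vector) \<Rightarrow> bool" where
  "holo_on J J' S f \<longleftrightarrow> smooth_on S f \<and>
     (\<forall>x\<in>S. \<forall>v. frechet_derivative f (at x) (J v) = J' (frechet_derivative f (at x) v))"

definition mult_i :: "complex ^ 'n \<Rightarrow> complex ^ 'n" where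
  "mult_i v = \<i> *s v"

section \<open>Complex manifolds and complex Lie groups\<close>

text \<open>A chart is a pair of its domain and its coordinate map; outside the domain the values of the
  coordinate map are irrelevant.\<close>

type_synonym ('g, 'n) chart = "'g set \<times> ('g \<Rightarrow> complex ^ 'n)"

abbreviation chart_dom :: "('g, 'n) chart \<Rightarrow> 'g set" where
  "chart_dom c \<equiv> fst c"

abbreviation chart_fun :: "('g, 'n) chart \<Rightarrow> 'g \<Rightarrow> complex ^ 'n" where
  "chart_fun c \<equiv> snd c"

abbreviation chart_img :: "('g, 'n) chart \<Rightarrow> (complex ^ 'n) set" where
  "chart_img c \<equiv> chart_fun c ` chart_dom c"

definition chart_inv :: "('g, 'n) chart \<Rightarrow> complex ^ 'n \<Rightarrow> 'g" where
  "chart_inv c = inv_into (chart_dom c) (chart_fun c)"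

definition is_chart :: "'g topology \<Rightarrow> ('g, 'n::finite) chart \<Rightarrow> bool" where
  "is_chart T c \<longleftrightarrow> openin T (chart_dom c) \<and> open (chart_img c) \<and>
     homeomorphic_map (subtopology T (chart_dom c)) (top_of_set (chart_img c)) (chart_fun c)"

definition complex_manifold :: "'g topology \<Rightarrow> ('g, 'n::finite) chart set \<Rightarrow> bool" where
  "complex_manifold T A \<longleftrightarrow> Hausdorff_space T \<and> second_countable T \<and>
     (\<forall>c\<in>A. is_chart T c) \<and> (\<Union>c\<in>A. chart_dom c) = topspace T \<and>
     (\<forall>c\<in>A. \<forall>c'\<in>A. holo_on mult_i mult_i (chart_fun c ` (chart_dom c \<inter> chart_dom c'))
        (chart_fun c' \<circ> chart_inv c))"

definition smooth_self_map :: "'g topology \<Rightarrow> ('g, 'n::finite) chart set \<Rightarrow> ('g \<Rightarrow> 'g) \<Rightarrow> bool" where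
  "smooth_self_map T A F \<longleftrightarrow> continuous_map T T F \<and>
     (\<forall>c\<in>A. \<forall>c'\<in>A. smooth_on (chart_fun c ` {g \<in> chart_dom c. F g \<in> chart_dom c'})
        (chart_fun c' \<circ> F \<circ> chart_inv c))"

definition holo_self_map :: "'g topology \<Rightarrow> ('g, 'n::finite) chart set \<Rightarrow> ('g \<Rightarrow> 'g) \<Rightarrow> bool" where
  "holo_self_map T A F \<longleftrightarrow> continuous_map T T F \<and>
     (\<forall>c\<in>A. \<forall>c'\<in>A. holo_on mult_i mult_i (chart_fun c ` {g \<in> chart_dom c. F g \<in> chart_dom c'})
        (chart_fun c' \<circ> F \<circ> chart_inv c))"

definition holo_binary_map ::
  "'g topology \<Rightarrow> ('g, 'n::finite) chart set \<Rightarrow> ('g \<Rightarrow> 'g \<Rightarrow> 'g) \<Rightarrow> bool" where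
  "holo_binary_map T A m \<longleftrightarrow> continuous_map (prod_topology T T) T (\<lambda>(g, h). m g h) \<and>
     (\<forall>c\<in>A. \<forall>d\<in>A. \<forall>c'\<in>A. holo_on (map_prod mult_i mult_i) mult_i
        {(chart_fun c g, chart_fun d h) | g h.
           g \<in> chart_dom c \<and> h \<in> chart_dom d \<and> m g h \<in> chart_dom c'}
        (\<lambda>(x, y). chart_fun c' (m (chart_inv c x) (chart_inv d y))))"

text \<open>Smooth maps from the whole of a normed space (here the line or the plane) to a manifold.\<close>

definition smooth_into ::
  "'g topology \<Rightarrow> ('g, 'n::finite) chart set \<Rightarrow> ('e::real_normed_vector \<Rightarrow> 'g) \<Rightarrow> bool" where
  "smooth_into T A f \<longleftrightarrow> continuous_map euclidean T f \<and>
     (\<forall>c\<in>A. smooth_on {p. f p \<in> chart_dom c} (chart_fun c \<circ> f))"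

definition complex_lie_group :: "'g monoid \<Rightarrow> 'g topology \<Rightarrow> ('g, 'n::finite) chart set \<Rightarrow> bool" where
  "complex_lie_group G T A \<longleftrightarrow> group G \<and> topspace T = carrier G \<and> complex_manifold T A \<and>
     holo_binary_map T A (\<lambda>g h. g \<otimes>\<^bsub>G\<^esub> h) \<and> holo_self_map T A (\<lambda>g. inv\<^bsub>G\<^esub> g)"

section \<open>The Lie algebra\<close>

text \<open>Fix a chart \<open>c\<close> around the identity. Its differential at the identity identifies the tangent
  space there, i.e. the Lie algebra of the group, with \<open>complex ^ 'n\<close>; all tangent vectors at the
  identity below are expressed in this way. A different chart changes everything by a complex linear
  isomorphism.\<close>

definition differential_at_one ::
  "'g monoid \<Rightarrow> ('g, 'n::finite) chart \<Rightarrow> ('g \<Rightarrow> 'g) \<Rightarrow> complex ^ 'n \<Rightarrow> complex ^ 'n" where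
  "differential_at_one G c F =
     frechet_derivative (chart_fun c \<circ> F \<circ> chart_inv c) (at (chart_fun c \<one>\<^bsub>G\<^esub>))"

definition Ad :: "'g monoid \<Rightarrow> ('g, 'n::finite) chart \<Rightarrow> 'g \<Rightarrow> complex ^ 'n \<Rightarrow> complex ^ 'n" where
  "Ad G c g = differential_at_one G c (\<lambda>h. g \<otimes>\<^bsub>G\<^esub> h \<otimes>\<^bsub>G\<^esub> inv\<^bsub>G\<^esub> g)"

text \<open>The bracket is \<open>[X, Y] = ad(X) Y\<close>, where \<open>ad\<close> is the differential of \<open>Ad\<close> at the identity.\<close>

definition lie_bracket ::
  "'g monoid \<Rightarrow> ('g, 'n::finite) chart \<Rightarrow> complex ^ 'n \<Rightarrow> complex ^ 'n \<Rightarrow> complex ^ 'n" where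
  "lie_bracket G c X Y =
     frechet_derivative (\<lambda>z. Ad G c (chart_inv c z) Y) (at (chart_fun c \<one>\<^bsub>G\<^esub>)) X"

definition lie_ideal :: "'g monoid \<Rightarrow> ('g, 'n::finite) chart \<Rightarrow> (complex ^ 'n) set \<Rightarrow> bool" where
  "lie_ideal G c I \<longleftrightarrow> vec.subspace I \<and> (\<forall>X. \<forall>Y\<in>I. lie_bracket G c X Y \<in> I)"

fun derived_series ::
  "'g monoid \<Rightarrow> ('g, 'n::finite) chart \<Rightarrow> nat \<Rightarrow> (complex ^ 'n) set \<Rightarrow> (complex ^ 'n) set" where
  "derived_series G c 0 I = I"
| "derived_series G c (Suc k) I =
     vec.span {lie_bracket G c X Y | X Y. X \<in> derived_series G c k I \<and> Y \<in> derived_series G c k I}"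

definition semisimple :: "'g monoid \<Rightarrow> ('g, 'n::finite) chart \<Rightarrow> bool" where
  "semisimple G c \<longleftrightarrow>
     (\<forall>I. lie_ideal G c I \<and> (\<exists>k. derived_series G c k I = {0}) \<longrightarrow> I = {0})"

text \<open>The Lie algebra of a subgroup, as the set of its tangent vectors at the identity.\<close>

definition lie_algebra_of ::
  "'g monoid \<Rightarrow> 'g topology \<Rightarrow> ('g, 'n::finite) chart set \<Rightarrow> ('g, 'n) chart \<Rightarrow> 'g set \<Rightarrow>
     (complex ^ 'n) set" where
  "lie_algebra_of G T A c H = {X. \<exists>\<gamma> :: real \<Rightarrow> 'g. smooth_into T A \<gamma> \<and> range \<gamma> \<subseteq> H \<and>
     \<gamma> 0 = \<one>\<^bsub>G\<^esub> \<and> ((chart_fun c \<circ> \<gamma>) has_vector_derivative X) (at 0)}"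

text \<open>For a curve \<open>\<gamma>\<close> in the group, \<open>\<gamma>\<^sup>-\<^sup>1 \<gamma>'\<close> at \<open>t\<close>: the tangent vector \<open>\<gamma>'(t)\<close> moved to the
  identity by left translation.\<close>

definition left_log_deriv ::
  "'g monoid \<Rightarrow> ('g, 'n::finite) chart \<Rightarrow> (real \<Rightarrow> 'g) \<Rightarrow> real \<Rightarrow> complex ^ 'n" where
  "left_log_deriv G c \<gamma> t =
     vector_derivative (\<lambda>r. chart_fun c (inv\<^bsub>G\<^esub> (\<gamma> t) \<otimes>\<^bsub>G\<^esub> \<gamma> r)) (at t)"

section \<open>Involutions and the symmetric space\<close>

definition lie_involution ::
  "'g monoid \<Rightarrow> 'g topology \<Rightarrow> ('g, 'n::finite) chart set \<Rightarrow> ('g \<Rightarrow> 'g) \<Rightarrow> bool" where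
  "lie_involution G T A \<theta> \<longleftrightarrow> \<theta> \<in> iso G G \<and> smooth_self_map T A \<theta> \<and>
     (\<forall>g\<in>carrier G. \<theta> (\<theta> g) = g) \<and> (\<exists>g\<in>carrier G. \<theta> g \<noteq> g)"

definition complex_linear :: "(complex ^ 'n::finite \<Rightarrow> complex ^ 'n) \<Rightarrow> bool" where
  "complex_linear L \<longleftrightarrow> Vector_Spaces.linear (*s) (*s) L"

definition conjugate_linear :: "(complex ^ 'n::finite \<Rightarrow> complex ^ 'n) \<Rightarrow> bool" where
  "conjugate_linear L \<longleftrightarrow> (\<forall>X Y. L (X + Y) = L X + L Y) \<and> (\<forall>z X. L (z *s X) = cnj z *s L X)"

definition fixed_in :: "'g set \<Rightarrow> ('g \<Rightarrow> 'g) \<Rightarrow> 'g set" where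
  "fixed_in H \<theta> = {g \<in> H. \<theta> g = g}"

definition plus_space :: "('v \<Rightarrow> 'v) \<Rightarrow> 'v set \<Rightarrow> 'v set" where
  "plus_space L V = {X \<in> V. L X = X}"

definition minus_space :: "('v \<Rightarrow> 'v) \<Rightarrow> 'v::uminus set \<Rightarrow> 'v set" where
  "minus_space L V = {X \<in> V. L X = - X}"

definition M_sigma :: "'g monoid \<Rightarrow> 'g set \<Rightarrow> ('g \<Rightarrow> 'g) \<Rightarrow> 'g set" where
  "M_sigma G U \<sigma> = {g \<otimes>\<^bsub>G\<^esub> inv\<^bsub>G\<^esub> (\<sigma> g) | g. g \<in> U}"

definition coset_space :: "'g monoid \<Rightarrow> 'g set \<Rightarrow> 'g set \<Rightarrow> 'g set set" where
  "coset_space G U K = {g <#\<^bsub>G\<^esub> K | g. g \<in> U}"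

text \<open>\<open>gK \<mapsto> g \<sigma>(g)\<^sup>-\<^sup>1\<close>\<close>

definition cartan_embedding :: "'g monoid \<Rightarrow> ('g \<Rightarrow> 'g) \<Rightarrow> 'g set \<Rightarrow> 'g" where
  "cartan_embedding G \<sigma> C = (THE m. \<exists>g\<in>C. m = g \<otimes>\<^bsub>G\<^esub> inv\<^bsub>G\<^esub> (\<sigma> g))"

section \<open>Wave maps and the \<open>-1\<close> flow\<close>

text \<open>Here \<open>s\<close> is a function of \<open>(x, t)\<close>. As \<open>U\<close> is a closed subgroup, hence an embedded
  submanifold, a map into \<open>U\<close> is smooth iff it is smooth as a map into \<open>G\<close>.\<close>

definition wave_map_into ::
  "'g monoid \<Rightarrow> 'g topology \<Rightarrow> ('g, 'n::finite) chart set \<Rightarrow> ('g, 'n) chart \<Rightarrow> 'g set \<Rightarrow>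
     (real \<Rightarrow> real \<Rightarrow> 'g) \<Rightarrow> bool" where
  "wave_map_into G T A c U s \<longleftrightarrow>
     smooth_into T A (\<lambda>(x, t). s x t) \<and> (\<forall>x t. s x t \<in> U) \<and>
     (\<forall>x t. vector_derivative (\<lambda>t'. left_log_deriv G c (\<lambda>r. s x r) t') (at t) =
            vector_derivative (\<lambda>x'. left_log_deriv G c (\<lambda>r. s r t) x') (at x))"

text \<open>The Cartan embedding is a totally geodesic embedding of \<open>U/K\<close> onto \<open>M_sigma\<close>; wave maps into
  \<open>U/K\<close> are the maps which it turns into wave maps into \<open>U\<close>.\<close>

definition wave_map_into_symmetric_space ::
  "'g monoid \<Rightarrow> 'g topology \<Rightarrow> ('g, 'n::finite) chart set \<Rightarrow> ('g, 'n) chart \<Rightarrow> 'g set \<Rightarrow>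
     'g set \<Rightarrow> ('g \<Rightarrow> 'g) \<Rightarrow> (real \<Rightarrow> real \<Rightarrow> 'g set) \<Rightarrow> bool" where
  "wave_map_into_symmetric_space G T A c U K \<sigma> f \<longleftrightarrow>
     (\<forall>x t. f x t \<in> coset_space G U K) \<and>
     wave_map_into G T A c U (\<lambda>x t. cartan_embedding G \<sigma> (f x t))"

text \<open>The functions in the next two definitions have the characteristic coordinates
  \<open>\<xi> = (x + t)/2\<close>, \<open>\<eta> = (x - t)/2\<close> as arguments.\<close>

definition minus_one_flow ::
  "'g monoid \<Rightarrow> ('g, 'n::finite) chart \<Rightarrow> (complex ^ 'n) set \<Rightarrow>
     (real \<Rightarrow> real \<Rightarrow> complex ^ 'n) \<Rightarrow> (real \<Rightarrow> real \<Rightarrow> complex ^ 'n) \<Rightarrow>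
     (real \<Rightarrow> real \<Rightarrow> complex ^ 'n) \<Rightarrow> bool" where
  "minus_one_flow G c \<U> a u v \<longleftrightarrow>
     smooth_on UNIV (\<lambda>(\<xi>, \<eta>). a \<xi> \<eta>) \<and> smooth_on UNIV (\<lambda>(\<xi>, \<eta>). u \<xi> \<eta>) \<and>
     smooth_on UNIV (\<lambda>(\<xi>, \<eta>). v \<xi> \<eta>) \<and>
     (\<forall>\<xi> \<eta>. a \<xi> \<eta> \<in> \<U> \<and> u \<xi> \<eta> \<in> \<U> \<and> v \<xi> \<eta> \<in> \<U>) \<and>
     (\<forall>\<xi> \<eta>. vector_derivative (\<lambda>r. a \<xi> r) (at \<eta>) = 0 \<and>
            vector_derivative (\<lambda>r. u \<xi> r) (at \<eta>) = lie_bracket G c (a \<xi> \<eta>) (v \<xi> \<eta>) \<and>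
            vector_derivative (\<lambda>r. v r \<eta>) (at \<xi>) = - lie_bracket G c (u \<xi> \<eta>) (v \<xi> \<eta>))"

definition trivialization ::
  "'g monoid \<Rightarrow> 'g topology \<Rightarrow> ('g, 'n::finite) chart set \<Rightarrow> ('g, 'n) chart \<Rightarrow>
     (real \<Rightarrow> real \<Rightarrow> complex ^ 'n) \<Rightarrow> (real \<Rightarrow> real \<Rightarrow> complex ^ 'n) \<Rightarrow>
     (real \<Rightarrow> real \<Rightarrow> complex ^ 'n) \<Rightarrow> (real \<Rightarrow> real \<Rightarrow> complex \<Rightarrow> 'g) \<Rightarrow> bool" where
  "trivialization G T A c a u v E \<longleftrightarrow> (\<forall>z. z \<noteq> 0 \<longrightarrow>
     smooth_into T A (\<lambda>(\<xi>, \<eta>). E \<xi> \<eta> z) \<and> E 0 0 z = \<one>\<^bsub>G\<^esub> \<and>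
     (\<forall>\<xi> \<eta>. left_log_deriv G c (\<lambda>r. E r \<eta> z) \<xi> = z *s a \<xi> \<eta> + u \<xi> \<eta> \<and>
            left_log_deriv G c (\<lambda>r. E \<xi> r z) \<eta> = inverse z *s v \<xi> \<eta>))"

end

theory Submission
  imports Defs
begin

text \<open>As \<open>\<tau>\<close> fixes \<open>a\<close>, \<open>u\<close>, \<open>v\<close>, the maps \<open>\<tau>(E(\<cdot>, \<cdot>, \<plusminus>1))\<close> and \<open>E(\<cdot>, \<cdot>, \<plusminus>1)\<close> have the same
  logarithmic derivative and the same value at the origin, so \<open>E(\<cdot>, \<cdot>, \<plusminus>1)\<close> takes values in \<open>U\<close>.
  As \<open>\<sigma>\<close> maps \<open>(a + u, v)\<close> to \<open>(- a + u, - v)\<close>, uniqueness also gives \<open>\<sigma>(E(\<cdot>, \<cdot>, 1)) = E(\<cdot>, \<cdot>, -1)\<close>,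
  and \<open>s = g \<sigma>(g)\<^sup>-\<^sup>1\<close> for \<open>g = E(\<cdot>, \<cdot>, -1)\<close>. The wave equation for \<open>s\<close> is the flow equation for \<open>v\<close>,
  conjugated by \<open>Ad(E(\<cdot>, \<cdot>, 1))\<close>.\<close>

section \<open>Calculus of smooth maps\<close>

text \<open>The group is an abstract manifold, so everything is read in one chart at the identity:
  the logarithmic derivative of \<open>f\<close> at \<open>p\<close> is the derivative at
  \<open>q = p\<close> of the coordinates of \<open>inv (f p) \<otimes> f q\<close>. Two facts carry
  the argument. If f and g have logarithmic derivatives L and M, then
  \<open>f q \<otimes> inv (g q)\<close> has Ad(g)(L - M); for L = M this vanishes, so the quotient
  is locally constant in coordinates, hence constant on the plane. This is the uniqueness principle.
  Secondly, the bracket is by definition the derivative of \<open>Ad\<close> at the identity, so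
  Ad(g) Y has derivative Ad(g)([L, Y] + dY), where L now belongs to g. In the wave equation L is (a
  + u - v)/2 with Y = v - a, or (a + u + v)/2 with Y = -v - a, so L differs from u/2 by a multiple
  of Y. The law [X, X] = 0 removes that multiple; as the bracket is not given as a commutator, this
  law has to be extracted from the conjugation map.\<close>

lemma C_k_on_cong:
  assumes "open S" "\<And>x. x \<in> S \<Longrightarrow> f x = g x" "C_k_on k S f"
  shows "C_k_on k S g"
  using assms(2,3)
proof (induction k arbitrary: f g)
  case 0
  then show ?case by (simp cong: continuous_on_cong)
next
  case (Suc k)
  have d: "f differentiable (at x)" if "x \<in> S" for x using Suc.prems(2) that by simp
  have e: "frechet_derivative f (at x) = frechet_derivative g (at x)" if "x \<in> S" for x
    using frechet_derivative_transform_within_open[OF d[OF that] assms(1) that] Suc.prems(1) by blast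
  have "g differentiable (at x)" if "x \<in> S" for x
    using d[OF that] has_derivative_transform_within_open[OF _ assms(1) that] Suc.prems(1)
    unfolding differentiable_def by blast
  moreover have "C_k_on k S (\<lambda>x. frechet_derivative g (at x) v)" for v
    by (rule Suc.IH[of "\<lambda>x. frechet_derivative f (at x) v"]) (use e Suc.prems(2) in auto)
  ultimately show ?case by simp
qed

text \<open>Lets closure proofs name the derivative explicitly: by uniqueness of derivatives
  \<open>f' x\<close> is the one chosen by \<open>frechet_derivative\<close>, and
  \<open>C_k_on_cong\<close> transfers the regularity.\<close>

lemma C_k_on_SucI:
  assumes "open S" "\<And>x. x \<in> S \<Longrightarrow> (f has_derivative f' x) (at x)"
    and "\<And>v. C_k_on k S (\<lambda>x. f' x v)"
  shows "C_k_on (Suc k) S f"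
proof -
  have "f' x = frechet_derivative f (at x)" if "x \<in> S" for x
    using assms(2)[OF that] frechet_derivative_at by blast
  then have "C_k_on k S (\<lambda>x. frechet_derivative f (at x) v)" for v
    by (intro C_k_on_cong[OF assms(1) _ assms(3)[of v]]) auto
  then show ?thesis using assms(2) by (auto simp: differentiable_def)
qed

lemma C_k_on_SucD: "C_k_on (Suc k) S f \<Longrightarrow> C_k_on k S f"
proof (induction k arbitrary: f)
  case 0
  then show ?case
    by (auto intro!: continuous_at_imp_continuous_on dest: differentiable_imp_continuous_within)
next
  case (Suc k)
  show ?case
  proof (subst C_k_on.simps, intro conjI allI)
    show "\<forall>x\<in>S. f differentiable (at x)" using Suc.prems by simp
    show "C_k_on k S (\<lambda>x. frechet_derivative f (at x) v)" for v
      by (rule Suc.IH) (use Suc.prems in \<open>subst (asm) C_k_on.simps, blast\<close>)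
  qed
qed

lemma C_k_on_has_derivative:
  "C_k_on (Suc k) S f \<Longrightarrow> x \<in> S \<Longrightarrow> (f has_derivative frechet_derivative f (at x)) (at x)"
  by (simp add: frechet_derivative_works)

lemma C_k_on_subset: "C_k_on k S f \<Longrightarrow> S' \<subseteq> S \<Longrightarrow> C_k_on k S' f"
  by (induction k arbitrary: f) (auto intro: continuous_on_subset)

text \<open>Derivatives are taken \<open>at x\<close>, not within \<open>S\<close>, so the
  neighbourhood \<open>V\<close> may leave \<open>S\<close>. This is what allows smoothness to be
  checked chart by chart.\<close>

lemma C_k_on_local:
  assumes "\<And>x. x \<in> S \<Longrightarrow> \<exists>V. open V \<and> x \<in> V \<and> C_k_on k V f"
  shows "C_k_on k S f"
  using assms
proof (induction k arbitrary: f)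
  case 0
  then show ?case
    by (metis C_k_on.simps(1) continuous_at_imp_continuous_on continuous_on_eq_continuous_at)
next
  case (Suc k)
  have "C_k_on k S (\<lambda>x. frechet_derivative f (at x) v)" for v
    by (rule Suc.IH) (use Suc.prems in \<open>simp, blast\<close>)
  moreover have "\<forall>x\<in>S. f differentiable (at x)" using Suc.prems C_k_on.simps(2) by metis
  ultimately show ?case by simp
qed

lemma C_k_on_const: "C_k_on k S (\<lambda>x. c)"
  by (induction k arbitrary: c) auto

lemma C_k_on_add:
  assumes "open S" "C_k_on k S f" "C_k_on k S g"
  shows "C_k_on k S (\<lambda>x. f x + g x)"
  using assms(2,3)
proof (induction k arbitrary: f g)
  case 0
  then show ?case by (auto intro: continuous_on_add)
next
  case (Suc k)
  show ?case
  proof (rule C_k_on_SucI[OF assms(1)])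
    show "((\<lambda>x. f x + g x) has_derivative
        (\<lambda>v. frechet_derivative f (at x) v + frechet_derivative g (at x) v)) (at x)" if "x \<in> S" for x
      using Suc.prems that by (intro has_derivative_add C_k_on_has_derivative)
    show "C_k_on k S (\<lambda>x. frechet_derivative f (at x) v + frechet_derivative g (at x) v)" for v
      using Suc.prems by (intro Suc.IH) auto
  qed
qed

lemma C_k_on_sum:
  assumes "open S" "\<And>i. i \<in> I \<Longrightarrow> C_k_on k S (f i)"
  shows "C_k_on k S (\<lambda>x. \<Sum>i\<in>I. f i x)"
  using assms(2)
  by (induction I rule: infinite_finite_induct) (auto intro: C_k_on_const C_k_on_add[OF assms(1)])

lemma C_k_on_scaleR:
  assumes "open S" "C_k_on k S f" "C_k_on k S g"
  shows "C_k_on k S (\<lambda>x. f x *\<^sub>R g x)"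
  using assms(2,3)
proof (induction k arbitrary: f g)
  case 0
  then show ?case by (auto intro: continuous_on_scaleR)
next
  case (Suc k)
  note down = Suc.prems[THEN C_k_on_SucD]
  show ?case
  proof (rule C_k_on_SucI[OF assms(1)])
    show "((\<lambda>x. f x *\<^sub>R g x) has_derivative
        (\<lambda>v. f x *\<^sub>R frechet_derivative g (at x) v + frechet_derivative f (at x) v *\<^sub>R g x)) (at x)"
      if "x \<in> S" for x
      using Suc.prems that by (intro has_derivative_scaleR C_k_on_has_derivative)
    show "C_k_on k S (\<lambda>x. f x *\<^sub>R frechet_derivative g (at x) v + frechet_derivative f (at x) v *\<^sub>R g x)" for v
      using Suc.prems down by (intro C_k_on_add[OF assms(1)] Suc.IH) auto
  qed
qed

lemma C_k_on_bounded_linear_compose: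
  assumes "open S" "bounded_linear L" "C_k_on k S f"
  shows "C_k_on k S (\<lambda>x. L (f x))"
  using assms(3)
proof (induction k arbitrary: f)
  case 0
  then show ?case using assms(2) by (auto intro: bounded_linear.continuous_on)
next
  case (Suc k)
  show ?case
  proof (rule C_k_on_SucI[OF assms(1)])
    show "((\<lambda>x. L (f x)) has_derivative (\<lambda>v. L (frechet_derivative f (at x) v))) (at x)"
      if "x \<in> S" for x
      using bounded_linear.has_derivative[OF assms(2) C_k_on_has_derivative[OF Suc.prems that]] .
    show "C_k_on k S (\<lambda>x. L (frechet_derivative f (at x) v))" for v
      using Suc.prems by (intro Suc.IH) auto
  qed
qed

lemma C_k_on_id: "C_k_on k S (\<lambda>x. x)"
proof -
  have "C_k_on k UNIV (\<lambda>x::'a. x)"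
    by (cases k) (auto intro!: C_k_on_SucI[where f' = "\<lambda>x v. v"] C_k_on_const)
  then show ?thesis by (rule C_k_on_subset) simp
qed

lemma C_k_on_bounded_linear:
  assumes "bounded_linear L"
  shows "C_k_on k S L"
  using C_k_on_bounded_linear_compose[OF open_UNIV assms C_k_on_id] C_k_on_subset by blast

lemma C_k_on_Pair:
  assumes "open S" "C_k_on k S f" "C_k_on k S g"
  shows "C_k_on k S (\<lambda>x. (f x, g x))"
proof -
  have "C_k_on k S (\<lambda>x. (f x, 0) + (0, g x))"
    by (intro C_k_on_add[OF assms(1)] C_k_on_bounded_linear_compose[OF assms(1) _ assms(2)]
        C_k_on_bounded_linear_compose[OF assms(1) _ assms(3)])
      (intro bounded_linear_Pair bounded_linear_ident bounded_linear_zero)+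
  then show ?thesis by simp
qed

text \<open>The chain rule evaluates the derivative of \<open>g\<close> in the direction of a vector
  that moves with \<open>x\<close>, whereas \<open>C_k_on\<close> controls derivatives in fixed
  directions only. Expanding that vector in \<open>Basis\<close> turns the derivative into a sum of
  products to which the induction hypothesis applies; hence the Euclidean middle space.\<close>

lemma C_k_on_compose:
  fixes f :: "'a::real_normed_vector \<Rightarrow> 'b::euclidean_space"
  assumes "open S" "f ` S \<subseteq> R" "C_k_on k S f" "C_k_on k R g"
  shows "C_k_on k S (\<lambda>x. g (f x))"
  using assms(3,4)
proof (induction k arbitrary: g)
  case 0
  then show ?case using assms(2) by (auto intro: continuous_on_compose2)
next
  case (Suc k)
  show ?case
  proof (rule C_k_on_SucI[OF assms(1)])
    fix x assume x: "x \<in> S"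
    have g: "(g has_derivative frechet_derivative g (at (f x))) (at (f x))"
      using C_k_on_has_derivative[OF Suc.prems(2)] assms(2) x by blast
    have expand: "frechet_derivative g (at (f x)) y =
        (\<Sum>b\<in>Basis. (y \<bullet> b) *\<^sub>R frechet_derivative g (at (f x)) b)" for y
    proof -
      have "frechet_derivative g (at (f x)) (\<Sum>b\<in>Basis. (y \<bullet> b) *\<^sub>R b) =
          (\<Sum>b\<in>Basis. (y \<bullet> b) *\<^sub>R frechet_derivative g (at (f x)) b)"
        by (simp add: linear_sum[OF has_derivative_linear[OF g]] linear_scale[OF has_derivative_linear[OF g]])
      then show ?thesis by (simp add: euclidean_representation)
    qed
    show "((\<lambda>x. g (f x)) has_derivative
        (\<lambda>v. \<Sum>b\<in>Basis. (frechet_derivative f (at x) v \<bullet> b) *\<^sub>R frechet_derivative g (at (f x)) b)) (at x)"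
      using has_derivative_compose[OF C_k_on_has_derivative[OF Suc.prems(1) x] g]
      by (subst (asm) expand)
  next
    fix v
    have "C_k_on k S (\<lambda>x. frechet_derivative f (at x) v \<bullet> b)" for b
      using Suc.prems(1) by (intro C_k_on_bounded_linear_compose[OF assms(1) bounded_linear_inner_left]) simp
    moreover have "C_k_on k S (\<lambda>x. frechet_derivative g (at (f x)) b)" for b
      using Suc.IH[OF C_k_on_SucD[OF Suc.prems(1)], of "\<lambda>y. frechet_derivative g (at y) b"] Suc.prems(2)
      by simp
    ultimately show "C_k_on k S (\<lambda>x. \<Sum>b\<in>Basis. (frechet_derivative f (at x) v \<bullet> b) *\<^sub>R
        frechet_derivative g (at (f x)) b)"
      by (intro C_k_on_sum[OF assms(1)] C_k_on_scaleR[OF assms(1)])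
  qed
qed

lemma smooth_on_cong:
  "open S \<Longrightarrow> (\<And>x. x \<in> S \<Longrightarrow> f x = g x) \<Longrightarrow> smooth_on S f \<Longrightarrow> smooth_on S g"
  unfolding smooth_on_def using C_k_on_cong by blast

lemma smooth_on_subset: "smooth_on S f \<Longrightarrow> S' \<subseteq> S \<Longrightarrow> smooth_on S' f"
  unfolding smooth_on_def using C_k_on_subset by blast

lemma smooth_on_local:
  "(\<And>x. x \<in> S \<Longrightarrow> \<exists>V. open V \<and> x \<in> V \<and> smooth_on V f) \<Longrightarrow> smooth_on S f"
  unfolding smooth_on_def by (meson C_k_on_local)

lemma smooth_on_compose:
  fixes f :: "'a::real_normed_vector \<Rightarrow> 'b::euclidean_space"
  shows "open S \<Longrightarrow> f ` S \<subseteq> R \<Longrightarrow> smooth_on S f \<Longrightarrow> smooth_on R g \<Longrightarrow> smooth_on S (\<lambda>x. g (f x))"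
  unfolding smooth_on_def using C_k_on_compose by blast

lemma smooth_on_Pair:
  "open S \<Longrightarrow> smooth_on S f \<Longrightarrow> smooth_on S g \<Longrightarrow> smooth_on S (\<lambda>x. (f x, g x))"
  unfolding smooth_on_def using C_k_on_Pair by blast

lemma smooth_on_bounded_linear: "bounded_linear L \<Longrightarrow> smooth_on S L"
  unfolding smooth_on_def using C_k_on_bounded_linear by blast

lemma smooth_on_const: "smooth_on S (\<lambda>x. c)"
  unfolding smooth_on_def using C_k_on_const by blast

lemma smooth_on_has_derivative:
  "smooth_on S f \<Longrightarrow> x \<in> S \<Longrightarrow> (f has_derivative frechet_derivative f (at x)) (at x)"
  unfolding smooth_on_def using C_k_on_has_derivative by blast

lemma smooth_on_frechet_derivative:
  "smooth_on S f \<Longrightarrow> smooth_on S (\<lambda>x. frechet_derivative f (at x) v)"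
  unfolding smooth_on_def by (metis C_k_on.simps(2))

section \<open>Smooth maps into a manifold\<close>

text \<open>A version of \<open>smooth_into\<close> on a subset, because chart inverses live only on
  \<open>chart_img\<close>. Openness of \<open>S\<close> is built in so that preimages of chart
  domains are open in the whole space.\<close>

definition smooth_into_on ::
  "'g topology \<Rightarrow> ('g, 'n::finite) chart set \<Rightarrow> 'e::real_normed_vector set \<Rightarrow> ('e \<Rightarrow> 'g) \<Rightarrow> bool" where
  "smooth_into_on T A S f \<longleftrightarrow> open S \<and> continuous_map (top_of_set S) T f \<and>
     (\<forall>c\<in>A. smooth_on {p \<in> S. f p \<in> chart_dom c} (chart_fun c \<circ> f))"

lemma smooth_into_iff_on: "smooth_into T A f \<longleftrightarrow> smooth_into_on T A UNIV f"
  by (simp add: smooth_into_def smooth_into_on_def)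

lemma smooth_into_on_open: "smooth_into_on T A S f \<Longrightarrow> open S"
  by (simp add: smooth_into_on_def)

lemma smooth_into_on_open_preimage:
  assumes "smooth_into_on T A S f" "openin T D"
  shows "open {p \<in> S. f p \<in> D}"
proof -
  have "openin (top_of_set S) {p \<in> topspace (top_of_set S). f p \<in> D}"
    using assms unfolding smooth_into_on_def by (blast intro: openin_continuous_map_preimage)
  then show ?thesis using assms(1) openin_open_eq[of S] by (simp add: smooth_into_on_def)
qed

lemma smooth_into_on_topspace: "smooth_into_on T A S f \<Longrightarrow> p \<in> S \<Longrightarrow> f p \<in> topspace T"
  unfolding smooth_into_on_def continuous_map_def by auto

lemma smooth_into_on_compose:
  fixes h :: "'a::real_normed_vector \<Rightarrow> 'b::euclidean_space"
  assumes f: "smooth_into_on T A R f" and S: "open S" "smooth_on S h" "h ` S \<subseteq> R"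
    and A: "\<And>c. c \<in> A \<Longrightarrow> openin T (chart_dom c)"
  shows "smooth_into_on T A S (\<lambda>p. f (h p))"
proof -
  have h: "continuous_on S h"
    using S(2) unfolding smooth_on_def by (metis C_k_on.simps(1))
  have cont: "continuous_map (top_of_set S) T (\<lambda>p. f (h p))"
    using continuous_map_compose[of "top_of_set S" "top_of_set R" h T f] h S(3) f
    by (simp add: smooth_into_on_def comp_def Pi_iff image_subset_iff)
  have "smooth_on {p \<in> S. f (h p) \<in> chart_dom c} (chart_fun c \<circ> (\<lambda>p. f (h p)))" if c: "c \<in> A" for c
  proof -
    have "open {p \<in> S. f (h p) \<in> chart_dom c}"
      using openin_continuous_map_preimage[OF cont A[OF c]] S(1) openin_open_eq by fastforce
    moreover have "smooth_on {p \<in> R. f p \<in> chart_dom c} (chart_fun c \<circ> f)"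
      using f c by (simp add: smooth_into_on_def)
    ultimately show ?thesis
      using smooth_on_compose[where f = h and S = "{p \<in> S. f (h p) \<in> chart_dom c}"
          and R = "{p \<in> R. f p \<in> chart_dom c}" and g = "chart_fun c \<circ> f"] S
      by (force simp: comp_def intro: smooth_on_subset)
  qed
  with cont S(1) show ?thesis by (simp add: smooth_into_on_def)
qed

lemma smooth_into_on_const:
  assumes "open S" "g \<in> topspace T"
  shows "smooth_into_on T A S (\<lambda>p. g)"
  using assms by (simp add: smooth_into_on_def comp_def smooth_on_const)

lemma smooth_into_on_I:
  assumes "open S" "continuous_map (top_of_set S) T f"
    and "\<And>p c. p \<in> S \<Longrightarrow> c \<in> A \<Longrightarrow> f p \<in> chart_dom c \<Longrightarrow>
      \<exists>V. open V \<and> p \<in> V \<and> smooth_on V (chart_fun c \<circ> f)"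
  shows "smooth_into_on T A S f"
  using assms unfolding smooth_into_on_def by (auto intro!: smooth_on_local)

section \<open>Chart inverses, self-maps and binary operations on a manifold\<close>

locale atlas_manifold =
  fixes T :: "'g topology" and A :: "('g, 'n::finite) chart set"
  assumes manifold: "complex_manifold T A"
begin

lemma openin_chart_dom: "d \<in> A \<Longrightarrow> openin T (chart_dom d)"
  using manifold by (simp add: complex_manifold_def is_chart_def)

lemma open_chart_img: "d \<in> A \<Longrightarrow> open (chart_img d)"
  using manifold by (simp add: complex_manifold_def is_chart_def)

lemma chart_dom_subset: "d \<in> A \<Longrightarrow> chart_dom d \<subseteq> topspace T"
  using openin_chart_dom openin_subset by blast

lemma chart_homeo:
  "d \<in> A \<Longrightarrow> homeomorphic_map (subtopology T (chart_dom d)) (top_of_set (chart_img d)) (chart_fun d)"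
  using manifold by (simp add: complex_manifold_def is_chart_def)

lemma ex_chart: "g \<in> topspace T \<Longrightarrow> \<exists>d\<in>A. g \<in> chart_dom d"
  using manifold unfolding complex_manifold_def by blast

lemma chart_fun_inv: "x \<in> chart_img d \<Longrightarrow> chart_fun d (chart_inv d x) = x"
  unfolding chart_inv_def by (rule f_inv_into_f)

lemma chart_inv_fun:
  assumes "d \<in> A" "g \<in> chart_dom d"
  shows "chart_inv d (chart_fun d g) = g"
proof -
  have "inj_on (chart_fun d) (topspace (subtopology T (chart_dom d)))"
    using chart_homeo[OF assms(1)] unfolding homeomorphic_map_def by blast
  then have "inj_on (chart_fun d) (chart_dom d)"
    using chart_dom_subset[OF assms(1)] by (simp add: Int_absorb1)
  then show ?thesis using assms(2) unfolding chart_inv_def by simp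
qed

lemma continuous_map_chart_inv:
  assumes d: "d \<in> A"
  shows "continuous_map (top_of_set (chart_img d)) T (chart_inv d)"
proof -
  obtain g where g: "homeomorphic_maps (subtopology T (chart_dom d)) (top_of_set (chart_img d)) (chart_fun d) g"
    using chart_homeo[OF d] unfolding homeomorphic_map_maps by blast
  have "g x = chart_inv d x" if "x \<in> chart_img d" for x
  proof -
    have "g x \<in> chart_dom d" "chart_fun d (g x) = x"
      using g that unfolding homeomorphic_maps_def continuous_map_def by auto
    then show ?thesis using chart_inv_fun[OF d] by metis
  qed
  moreover have "continuous_map (top_of_set (chart_img d)) T g"
    using g unfolding homeomorphic_maps_def by (simp add: continuous_map_in_subtopology)
  ultimately show ?thesis by (auto intro: continuous_map_eq)
qed

text \<open>The coordinate expressions of a chart inverse are the transition maps of the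
  atlas.\<close>

lemma smooth_into_on_chart_inv:
  assumes d: "d \<in> A"
  shows "smooth_into_on T A (chart_img d) (chart_inv d)"
  unfolding smooth_into_on_def
proof (intro conjI ballI)
  show "open (chart_img d)" by (rule open_chart_img[OF d])
  show "continuous_map (top_of_set (chart_img d)) T (chart_inv d)"
    by (rule continuous_map_chart_inv[OF d])
  fix d' assume d': "d' \<in> A"
  have "{p \<in> chart_img d. chart_inv d p \<in> chart_dom d'} = chart_fun d ` (chart_dom d \<inter> chart_dom d')"
    using chart_inv_fun[OF d] by auto
  moreover have "smooth_on (chart_fun d ` (chart_dom d \<inter> chart_dom d')) (chart_fun d' \<circ> chart_inv d)"
    using manifold d d' unfolding complex_manifold_def holo_on_def by blast
  ultimately show "smooth_on {p \<in> chart_img d. chart_inv d p \<in> chart_dom d'} (chart_fun d' \<circ> chart_inv d)"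
    by simp
qed

lemma smooth_into_on_self_map:
  assumes F: "smooth_self_map T A F" and f: "smooth_into_on T A S f"
  shows "smooth_into_on T A S (\<lambda>p. F (f p))"
proof (rule smooth_into_on_I)
  show "open S" using f by (rule smooth_into_on_open)
  show cont: "continuous_map (top_of_set S) T (\<lambda>p. F (f p))"
    using continuous_map_compose[of "top_of_set S" T f T F] f F
    by (simp add: smooth_into_on_def smooth_self_map_def comp_def)
  fix p d' assume p: "p \<in> S" and d': "d' \<in> A" "F (f p) \<in> chart_dom d'"
  obtain d where d: "d \<in> A" "f p \<in> chart_dom d"
    using ex_chart smooth_into_on_topspace[OF f p] by blast
  \<comment> \<open>Near \<open>p\<close> the coordinate expression of \<open>F\<close> after
    \<open>f\<close> factors through the chart \<open>d\<close> at \<open>f p\<close>;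
    \<open>V\<close> is where both factors are defined.\<close>
  define V where "V = {q \<in> S. f q \<in> chart_dom d} \<inter> {q \<in> S. F (f q) \<in> chart_dom d'}"
  have "open {q \<in> S. F (f q) \<in> chart_dom d'}"
    using openin_continuous_map_preimage[OF cont openin_chart_dom[OF d'(1)]]
      openin_open_eq[OF smooth_into_on_open[OF f]] by fastforce
  then have V: "open V"
    using smooth_into_on_open_preimage[OF f openin_chart_dom[OF d(1)]] unfolding V_def by blast
  have "smooth_on V (\<lambda>q. (chart_fun d' \<circ> F \<circ> chart_inv d) ((chart_fun d \<circ> f) q))"
  proof (rule smooth_on_compose[OF V, where f = "chart_fun d \<circ> f" and g = "chart_fun d' \<circ> F \<circ> chart_inv d"])
    show "(chart_fun d \<circ> f) ` V \<subseteq> chart_fun d ` {g \<in> chart_dom d. F g \<in> chart_dom d'}"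
      by (auto simp: V_def)
    show "smooth_on (chart_fun d ` {g \<in> chart_dom d. F g \<in> chart_dom d'}) (chart_fun d' \<circ> F \<circ> chart_inv d)"
      using F d(1) d'(1) unfolding smooth_self_map_def by blast
    have "smooth_on {q \<in> S. f q \<in> chart_dom d} (chart_fun d \<circ> f)"
      using f d(1) unfolding smooth_into_on_def by blast
    then show "smooth_on V (chart_fun d \<circ> f)"
      by (rule smooth_on_subset) (auto simp: V_def)
  qed
  then have "smooth_on V (chart_fun d' \<circ> (\<lambda>p. F (f p)))"
    by (rule smooth_on_cong[OF V, rotated]) (auto simp: V_def chart_inv_fun[OF d(1)])
  moreover have "p \<in> V" using p d d' by (auto simp: V_def)
  ultimately show "\<exists>V. open V \<and> p \<in> V \<and> smooth_on V (chart_fun d' \<circ> (\<lambda>p. F (f p)))"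
    using V by blast
qed

lemma smooth_into_on_binary_map:
  assumes m: "holo_binary_map T A m" and f: "smooth_into_on T A S f" and g: "smooth_into_on T A S g"
  shows "smooth_into_on T A S (\<lambda>p. m (f p) (g p))"
proof (rule smooth_into_on_I)
  show "open S" using f by (rule smooth_into_on_open)
  have "continuous_map (top_of_set S) (prod_topology T T) (\<lambda>p. (f p, g p))"
    using f g by (simp add: smooth_into_on_def continuous_map_pairedI)
  then show cont: "continuous_map (top_of_set S) T (\<lambda>p. m (f p) (g p))"
    using continuous_map_compose[of "top_of_set S" "prod_topology T T" "\<lambda>p. (f p, g p)" T "\<lambda>(x, y). m x y"] m
    by (simp add: holo_binary_map_def comp_def)
  fix p c' assume p: "p \<in> S" and c': "c' \<in> A" "m (f p) (g p) \<in> chart_dom c'"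
  obtain d where d: "d \<in> A" "f p \<in> chart_dom d"
    using ex_chart smooth_into_on_topspace[OF f p] by blast
  obtain e where e: "e \<in> A" "g p \<in> chart_dom e"
    using ex_chart smooth_into_on_topspace[OF g p] by blast
  define V where "V = {q \<in> S. f q \<in> chart_dom d} \<inter> {q \<in> S. g q \<in> chart_dom e} \<inter>
    {q \<in> S. m (f q) (g q) \<in> chart_dom c'}"
  have "open {q \<in> S. m (f q) (g q) \<in> chart_dom c'}"
    using openin_continuous_map_preimage[OF cont openin_chart_dom[OF c'(1)]]
      openin_open_eq[OF smooth_into_on_open[OF f]] by fastforce
  then have V: "open V"
    using smooth_into_on_open_preimage[OF f openin_chart_dom[OF d(1)]]
      smooth_into_on_open_preimage[OF g openin_chart_dom[OF e(1)]] unfolding V_def by blast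
  define R where "R = {(chart_fun d g, chart_fun e h) | g h.
      g \<in> chart_dom d \<and> h \<in> chart_dom e \<and> m g h \<in> chart_dom c'}"
  have "smooth_on V (\<lambda>q. (\<lambda>(x, y). chart_fun c' (m (chart_inv d x) (chart_inv e y)))
      ((chart_fun d \<circ> f) q, (chart_fun e \<circ> g) q))"
  proof (rule smooth_on_compose[OF V, where R = R])
    show "(\<lambda>q. ((chart_fun d \<circ> f) q, (chart_fun e \<circ> g) q)) ` V \<subseteq> R"
      by (auto simp: V_def R_def)
    show "smooth_on R (\<lambda>(x, y). chart_fun c' (m (chart_inv d x) (chart_inv e y)))"
      using m d(1) e(1) c'(1) unfolding holo_binary_map_def holo_on_def R_def by blast
    have "smooth_on {q \<in> S. f q \<in> chart_dom d} (chart_fun d \<circ> f)"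
      "smooth_on {q \<in> S. g q \<in> chart_dom e} (chart_fun e \<circ> g)"
      using f g d(1) e(1) unfolding smooth_into_on_def by blast+
    then show "smooth_on V (\<lambda>q. ((chart_fun d \<circ> f) q, (chart_fun e \<circ> g) q))"
      by (intro smooth_on_Pair[OF V]; elim smooth_on_subset) (auto simp: V_def)
  qed
  then have "smooth_on V (chart_fun c' \<circ> (\<lambda>p. m (f p) (g p)))"
    by (rule smooth_on_cong[OF V, rotated]) (auto simp: V_def chart_inv_fun[OF d(1)] chart_inv_fun[OF e(1)])
  moreover have "p \<in> V" using p d e c' by (auto simp: V_def)
  ultimately show "\<exists>V. open V \<and> p \<in> V \<and> smooth_on V (chart_fun c' \<circ> (\<lambda>p. m (f p) (g p)))"
    using V by blast
qed

end

section \<open>Logarithmic derivatives\<close>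

lemma smooth_self_mapI: "holo_self_map T A F \<Longrightarrow> smooth_self_map T A F"
  by (simp add: holo_self_map_def smooth_self_map_def holo_on_def)

section \<open>Lie groups with a chart at the identity\<close>

locale lie_group_chart =
  fixes G :: "'g monoid" (structure) and T :: "'g topology" and A :: "('g, 'n::finite) chart set"
    and c :: "('g, 'n) chart"
  assumes lie: "complex_lie_group G T A" and chart: "c \<in> A" and one_dom: "\<one> \<in> chart_dom c"
begin

sublocale group G
  using lie by (simp add: complex_lie_group_def)

sublocale atlas_manifold T A
  using lie by unfold_locales (simp add: complex_lie_group_def)

abbreviation \<phi> :: "'g \<Rightarrow> complex ^ 'n" where "\<phi> \<equiv> chart_fun c"

abbreviation o\<^sub>G :: "complex ^ 'n" where "o\<^sub>G \<equiv> \<phi> \<one>"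

lemma o_img: "o\<^sub>G \<in> chart_img c"
  using one_dom by blast

lemma chart_inv_o [simp]: "chart_inv c o\<^sub>G = \<one>"
  by (rule chart_inv_fun[OF chart one_dom])

lemma topspace_carrier: "topspace T = carrier G"
  using lie by (simp add: complex_lie_group_def)

lemma smooth_carrier: "smooth_into_on T A S f \<Longrightarrow> p \<in> S \<Longrightarrow> f p \<in> carrier G"
  using smooth_into_on_topspace topspace_carrier by metis

lemma chart_inv_carrier: "z \<in> chart_img c \<Longrightarrow> chart_inv c z \<in> carrier G"
  using smooth_carrier[OF smooth_into_on_chart_inv[OF chart]] .

lemma smooth_mult:
  "smooth_into_on T A S f \<Longrightarrow> smooth_into_on T A S g \<Longrightarrow> smooth_into_on T A S (\<lambda>p. f p \<otimes> g p)"
  using smooth_into_on_binary_map[of "\<lambda>g h. g \<otimes> h"] lie by (simp add: complex_lie_group_def)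

lemma smooth_inv:
  "smooth_into_on T A S f \<Longrightarrow> smooth_into_on T A S (\<lambda>p. inv (f p))"
  using smooth_into_on_self_map[OF smooth_self_mapI, of "\<lambda>g. inv g"] lie
  by (simp add: complex_lie_group_def)

lemma smooth_const: "open S \<Longrightarrow> g \<in> carrier G \<Longrightarrow> smooth_into_on T A S (\<lambda>p. g)"
  using smooth_into_on_const topspace_carrier by metis

lemma smooth_compose:
  fixes h :: "'a::real_normed_vector \<Rightarrow> 'b::euclidean_space"
  assumes "smooth_into_on T A R f" "open S" "smooth_on S h" "h ` S \<subseteq> R"
  shows "smooth_into_on T A S (\<lambda>p. f (h p))"
  using smooth_into_on_compose[OF assms openin_chart_dom] .

lemma open_chart_preimage: "smooth_into_on T A S f \<Longrightarrow> open {q \<in> S. f q \<in> chart_dom c}"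
  using smooth_into_on_open_preimage openin_chart_dom[OF chart] by metis

lemma smooth_on_chart:
  "smooth_into_on T A S f \<Longrightarrow> smooth_on {q \<in> S. f q \<in> chart_dom c} (\<lambda>q. \<phi> (f q))"
  using chart by (auto simp: smooth_into_on_def comp_def)

lemma chart_differentiable:
  assumes "smooth_into_on T A S f" "p \<in> S" "f p \<in> chart_dom c"
  shows "(\<lambda>q. \<phi> (f q)) differentiable (at p)"
  using smooth_on_has_derivative[OF smooth_on_chart[OF assms(1)], of p] assms(2,3)
  unfolding differentiable_def by blast

text \<open>The chain rule through the group: \<open>F\<close> is differentiated in the chart and
  \<open>f\<close> enters by its coordinates. The factorisation of \<open>F (f q)\<close> through
  the chart holds only where \<open>f q\<close> lies in its domain, which is an open set containing
  \<open>p\<close>.\<close>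

lemma chart_has_derivative_compose:
  assumes f: "smooth_into_on T A S f" "p \<in> S" "f p \<in> chart_dom c"
    and L: "((\<lambda>q. \<phi> (f q)) has_derivative L) (at p)"
    and D: "((\<lambda>z. F (chart_inv c z)) has_derivative D) (at (\<phi> (f p)))"
  shows "((\<lambda>q. F (f q)) has_derivative (\<lambda>h. D (L h))) (at p)"
  using has_derivative_compose[OF L D]
  by (rule has_derivative_transform_within_open[OF _ open_chart_preimage[OF f(1)]])
    (use f in \<open>auto simp: chart_inv_fun[OF chart]\<close>)

text \<open>\<open>differential_at_one\<close> is a bare \<open>frechet_derivative\<close>,
  informative only once differentiability is known. Smoothness near the identity supplies it,
  provided \<open>F\<close> sends the identity into the same chart domain.\<close>

lemma differential_at_one_works:
  assumes "open V" "V \<subseteq> chart_img c" "o\<^sub>G \<in> V" "smooth_into_on T A V (\<lambda>z. F (chart_inv c z))"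
    and "F \<one> \<in> chart_dom c"
  shows "((\<lambda>z. \<phi> (F (chart_inv c z))) has_derivative differential_at_one G c F) (at o\<^sub>G)"
  using chart_differentiable[OF assms(4,3)] assms(5)
  by (simp add: differential_at_one_def frechet_derivative_works comp_def)

lemma self_map_differential:
  assumes "smooth_self_map T A F" "F \<one> = \<one>"
  shows "((\<lambda>z. \<phi> (F (chart_inv c z))) has_derivative differential_at_one G c F) (at o\<^sub>G)"
  using differential_at_one_works[OF open_chart_img[OF chart] order_refl o_img
      smooth_into_on_self_map[OF assms(1) smooth_into_on_chart_inv[OF chart]]] assms(2) one_dom by simp

section \<open>The adjoint representation\<close>

lemma Ad_works:
  assumes "g \<in> carrier G"
  shows "((\<lambda>z. \<phi> (g \<otimes> chart_inv c z \<otimes> inv g)) has_derivative Ad G c g) (at o\<^sub>G)"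
proof -
  have "smooth_into_on T A (chart_img c) (\<lambda>z. g \<otimes> chart_inv c z \<otimes> inv g)"
    using assms by (intro smooth_mult smooth_const smooth_into_on_chart_inv[OF chart] open_chart_img[OF chart]) auto
  then show ?thesis unfolding Ad_def
    using assms one_dom
    by (intro differential_at_one_works[OF open_chart_img[OF chart] order_refl o_img]) auto
qed

lemma Ad_bounded_linear: "g \<in> carrier G \<Longrightarrow> bounded_linear (Ad G c g)"
  using Ad_works has_derivative_bounded_linear by blast

text \<open>Conjugation by \<open>g \<otimes> h\<close> is the composite of two conjugations, each
  of which fixes the identity, so the chain rule there multiplies the differentials.\<close>

lemma Ad_mult:
  assumes g: "g \<in> carrier G" and h: "h \<in> carrier G"
  shows "Ad G c (g \<otimes> h) X = Ad G c g (Ad G c h X)"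
proof -
  have sm: "smooth_into_on T A (chart_img c) (\<lambda>z. h \<otimes> chart_inv c z \<otimes> inv h)"
    using h by (intro smooth_mult smooth_const smooth_into_on_chart_inv[OF chart] open_chart_img[OF chart]) auto
  have "((\<lambda>z. \<phi> (g \<otimes> (h \<otimes> chart_inv c z \<otimes> inv h) \<otimes> inv g)) has_derivative
      (\<lambda>X. Ad G c g (Ad G c h X))) (at o\<^sub>G)"
    using chart_has_derivative_compose[OF sm o_img, of "Ad G c h" "\<lambda>x. \<phi> (g \<otimes> x \<otimes> inv g)" "Ad G c g"]
      Ad_works[OF g] Ad_works[OF h] h one_dom by simp
  then have "((\<lambda>z. \<phi> ((g \<otimes> h) \<otimes> chart_inv c z \<otimes> inv (g \<otimes> h))) has_derivative
      (\<lambda>X. Ad G c g (Ad G c h X))) (at o\<^sub>G)"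
    by (rule has_derivative_transform_within_open[OF _ open_chart_img[OF chart] o_img])
      (use g h in \<open>simp add: inv_mult_group m_assoc chart_inv_carrier\<close>)
  from has_derivative_unique[OF this Ad_works] g h show ?thesis by (metis m_closed)
qed

lemma Ad_one: "Ad G c \<one> X = X"
proof -
  have "((\<lambda>z. z) has_derivative Ad G c \<one>) (at o\<^sub>G)"
    using Ad_works[OF one_closed]
    by (rule has_derivative_transform_within_open[OF _ open_chart_img[OF chart] o_img])
      (simp add: chart_inv_carrier chart_fun_inv)
  from has_derivative_unique[OF this has_derivative_ident] show ?thesis by metis
qed

text \<open>A linear \<open>D\<close> on pairs is determined by its values on the first axis and on
  the diagonal. On the axis the quotient is \<open>z\<close> itself, so \<open>D (X, 0) = X\<close>;
  on the diagonal it is constant, so \<open>D (X, X) = 0\<close>. This bypasses the separate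
  derivatives of product and inverse.\<close>

lemma has_derivative_quotient:
  "((\<lambda>(z, w). \<phi> (chart_inv c z \<otimes> inv (chart_inv c w))) has_derivative (\<lambda>(X, Y). X - Y))
     (at (o\<^sub>G, o\<^sub>G))"
proof -
  define Q where "Q = (\<lambda>p. \<phi> (chart_inv c (fst p) \<otimes> inv (chart_inv c (snd p))))"
  have op: "open (chart_img c \<times> chart_img c)"
    by (intro open_Times open_chart_img[OF chart])
  have "smooth_into_on T A (chart_img c \<times> chart_img c)
      (\<lambda>p. chart_inv c (fst p) \<otimes> inv (chart_inv c (snd p)))"
    by (intro smooth_mult smooth_inv smooth_compose[OF smooth_into_on_chart_inv[OF chart] op]
        smooth_on_bounded_linear bounded_linear_fst bounded_linear_snd) auto
  then have "Q differentiable (at (o\<^sub>G, o\<^sub>G))"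
    unfolding Q_def by (rule chart_differentiable) (use o_img one_dom in auto)
  then obtain D where D: "(Q has_derivative D) (at (o\<^sub>G, o\<^sub>G))"
    unfolding differentiable_def by blast
  have lin: "linear D" by (rule has_derivative_linear[OF D])
  have "((\<lambda>z. Q (z, o\<^sub>G)) has_derivative (\<lambda>X. D (X, 0))) (at o\<^sub>G)"
    by (rule has_derivative_compose[where f = "\<lambda>z. (z, o\<^sub>G)", OF _ D]) (auto intro!: derivative_eq_intros)
  then have "((\<lambda>z. z) has_derivative (\<lambda>X. D (X, 0))) (at o\<^sub>G)"
    by (rule has_derivative_transform_within_open[OF _ open_chart_img[OF chart] o_img])
      (simp add: Q_def chart_inv_carrier chart_fun_inv)
  from has_derivative_unique[OF this has_derivative_ident] have D1: "D (X, 0) = X" for X by metis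
  have "((\<lambda>z. Q (z, z)) has_derivative (\<lambda>X. D (X, X))) (at o\<^sub>G)"
    by (rule has_derivative_compose[where f = "\<lambda>z. (z, z)", OF _ D]) (auto intro!: derivative_eq_intros)
  then have "((\<lambda>z. o\<^sub>G) has_derivative (\<lambda>X. D (X, X))) (at o\<^sub>G)"
    by (rule has_derivative_transform_within_open[OF _ open_chart_img[OF chart] o_img])
      (simp add: Q_def chart_inv_carrier)
  from has_derivative_unique[OF this has_derivative_const] have D2: "D (X, X) = 0" for X by metis
  have "D (X, Y) = X - Y" for X Y
    using linear_add[OF lin, of "(X - Y, 0)" "(Y, Y)"] D1 D2 by simp
  then have "D = (\<lambda>(X, Y). X - Y)" by auto
  with D show ?thesis unfolding Q_def by (simp add: case_prod_unfold)
qed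

text \<open>The pullback by \<open>f\<close> of the left Maurer-Cartan form, at the single point
  \<open>p\<close>. Translating by \<open>inv (f p)\<close> brings the value at \<open>p\<close> to
  the identity, so the one chart \<open>c\<close> serves for all \<open>p\<close>. \<open>L\<close>
  is a total derivative, which handles lines and planes alike.\<close>

definition has_log_derivative ::
  "('e::real_normed_vector \<Rightarrow> 'g) \<Rightarrow> 'e \<Rightarrow> ('e \<Rightarrow> complex ^ 'n) \<Rightarrow> bool" where
  "has_log_derivative f p L \<longleftrightarrow> ((\<lambda>q. \<phi> (inv (f p) \<otimes> f q)) has_derivative L) (at p)"

lemma smooth_left_translate:
  "smooth_into_on T A S f \<Longrightarrow> p \<in> S \<Longrightarrow> smooth_into_on T A S (\<lambda>q. inv (f p) \<otimes> f q)"
  by (intro smooth_mult smooth_const) (auto simp: smooth_into_on_open smooth_carrier)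

lemma ex_log_derivative:
  assumes "smooth_into_on T A S f" "p \<in> S"
  obtains L where "has_log_derivative f p L"
  using chart_differentiable[OF smooth_left_translate[OF assms] assms(2)] one_dom smooth_carrier[OF assms]
  unfolding has_log_derivative_def differentiable_def by auto

text \<open>A homomorphism commutes with the left translations:
  \<open>F (inv (f p) \<otimes> f q)\<close> is \<open>inv (F (f p)) \<otimes> F (f q)\<close>. The
  chain rule at the identity does the rest.\<close>

lemma has_log_derivative_hom:
  assumes f: "smooth_into_on T A S f" "p \<in> S" and L: "has_log_derivative f p L"
    and F: "smooth_self_map T A F" "F \<in> hom G G"
  shows "has_log_derivative (\<lambda>q. F (f q)) p (\<lambda>h. differential_at_one G c F (L h))"
proof -
  interpret F: group_hom G G F
    by unfold_locales (rule F(2))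
  note fp = smooth_carrier[OF f(1)]
  have "((\<lambda>q. \<phi> (F (inv (f p) \<otimes> f q))) has_derivative (\<lambda>h. differential_at_one G c F (L h))) (at p)"
    using chart_has_derivative_compose[OF smooth_left_translate[OF f] f(2), of L "\<lambda>x. \<phi> (F x)"]
      L self_map_differential[OF F(1)] fp[OF f(2)] one_dom unfolding has_log_derivative_def by simp
  then show ?thesis unfolding has_log_derivative_def
    by (rule has_derivative_transform_within_open[OF _ smooth_into_on_open[OF f(1)] f(2)])
      (simp add: fp f(2))
qed

text \<open>With \<open>a\<close> and \<open>b\<close> the translates of \<open>f\<close> and
  \<open>g\<close> to the identity at \<open>p\<close>, the translate of the quotient is
  \<open>g p \<otimes> (a q \<otimes> inv (b q)) \<otimes> inv (g p)\<close>. The inner quotient has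
  derivative \<open>L h - M h\<close>, and the conjugation contributes \<open>Ad\<close>.\<close>

lemma has_log_derivative_quotient:
  assumes f: "smooth_into_on T A S f" and g: "smooth_into_on T A S g" and p: "p \<in> S"
    and L: "has_log_derivative f p L" and M: "has_log_derivative g p M"
  shows "has_log_derivative (\<lambda>q. f q \<otimes> inv (g q)) p (\<lambda>h. Ad G c (g p) (L h - M h))"
proof -
  define a where "a q = inv (f p) \<otimes> f q" for q
  define b where "b q = inv (g p) \<otimes> g q" for q
  note fc = smooth_carrier[OF f] and gc = smooth_carrier[OF g]
  have a: "smooth_into_on T A S a" and b: "smooth_into_on T A S b"
    unfolding a_def b_def using smooth_left_translate f g p by blast+
  have ap: "a p = \<one>" and bp: "b p = \<one>" unfolding a_def b_def using fc gc p by auto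
  have "((\<lambda>q. (\<phi> (a q), \<phi> (b q))) has_derivative (\<lambda>h. (L h, M h))) (at p)"
    using L M unfolding has_log_derivative_def a_def b_def by (rule has_derivative_Pair)
  from has_derivative_compose[OF this] has_derivative_quotient
  have "((\<lambda>q. \<phi> (chart_inv c (\<phi> (a q)) \<otimes> inv (chart_inv c (\<phi> (b q))))) has_derivative (\<lambda>h. L h - M h)) (at p)"
    unfolding ap bp by (force simp: case_prod_unfold)
  then have ab: "((\<lambda>q. \<phi> (a q \<otimes> inv (b q))) has_derivative (\<lambda>h. L h - M h)) (at p)"
    by (rule has_derivative_transform_within_open
        [where s = "{q \<in> S. a q \<in> chart_dom c} \<inter> {q \<in> S. b q \<in> chart_dom c}"])
      (use a b p ap bp one_dom in \<open>auto simp: open_chart_preimage open_Int chart_inv_fun[OF chart]\<close>)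
  have "((\<lambda>q. \<phi> (g p \<otimes> (a q \<otimes> inv (b q)) \<otimes> inv (g p))) has_derivative (\<lambda>h. Ad G c (g p) (L h - M h))) (at p)"
    using chart_has_derivative_compose[OF smooth_mult[OF a smooth_inv[OF b]] p _ ab,
        of "\<lambda>x. \<phi> (g p \<otimes> x \<otimes> inv (g p))"]
      Ad_works[OF gc[OF p]] ap bp one_dom by simp
  then show ?thesis unfolding has_log_derivative_def
    by (rule has_derivative_transform_within_open[OF _ smooth_into_on_open[OF f] p])
      (simp add: a_def b_def fc gc p inv_mult_group m_assoc)
qed

text \<open>On a ball where the translate \<open>a\<close> stays in the chart, its coordinates have
  zero derivative and are constant. Injectivity of the chart makes \<open>f\<close> locally
  constant, and the source space is connected.\<close>

lemma log_derivative_zero_imp_constant: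
  fixes f :: "'e::real_normed_vector \<Rightarrow> 'g"
  assumes f: "smooth_into_on T A UNIV f" and zero: "\<And>p. has_log_derivative f p (\<lambda>h. 0)"
  shows "f p = f q"
proof -
  note fc = smooth_carrier[OF f, OF UNIV_I]
  have "\<forall>\<^sub>F q in at p. f p = f q" for p
  proof -
    define a where "a q = inv (f p) \<otimes> f q" for q
    have a: "smooth_into_on T A UNIV a"
      unfolding a_def by (rule smooth_left_translate[OF f UNIV_I])
    define V where "V = {q \<in> UNIV. a q \<in> chart_dom c}"
    have V: "open V" unfolding V_def by (rule open_chart_preimage[OF a])
    have "p \<in> V" using one_dom fc by (simp add: V_def a_def)
    then obtain e where e: "e > 0" "ball p e \<subseteq> V" using V openE by blast
    \<comment> \<open>The hypothesis at \<open>r\<close> concerns the translate \<open>b\<close>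
      based at \<open>r\<close>, not \<open>a\<close>, which is based at \<open>p\<close>. They
      differ by a fixed left factor, \<open>a q = a r \<otimes> b q\<close>, and the derivative of
      that left translation sends 0 to 0.\<close>
    have D: "((\<lambda>q. \<phi> (a q)) has_derivative (\<lambda>h. 0)) (at r within ball p e)" if "r \<in> ball p e" for r
    proof -
      define b where "b q = inv (f r) \<otimes> f q" for q
      have b: "smooth_into_on T A UNIV b"
        unfolding b_def by (rule smooth_left_translate[OF f UNIV_I])
      have br: "b r = \<one>" unfolding b_def using fc by simp
      have ar: "a r \<in> chart_dom c" using that e unfolding V_def by blast
      have arc: "a r \<in> carrier G" unfolding a_def using fc by simp
      have "smooth_into_on T A (chart_img c) (\<lambda>z. a r \<otimes> chart_inv c z)"
        by (intro smooth_mult smooth_const smooth_into_on_chart_inv[OF chart] open_chart_img[OF chart] arc)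
      from chart_differentiable[OF this o_img] ar arc
      obtain D where D: "((\<lambda>z. \<phi> (a r \<otimes> chart_inv c z)) has_derivative D) (at o\<^sub>G)"
        unfolding differentiable_def by auto
      have "((\<lambda>q. \<phi> (a r \<otimes> b q)) has_derivative (\<lambda>h. D 0)) (at r)"
        using chart_has_derivative_compose[OF b UNIV_I _ _, of r "\<lambda>h. 0" "\<lambda>x. \<phi> (a r \<otimes> x)" D]
          zero[of r] D br one_dom unfolding has_log_derivative_def b_def[symmetric] by simp
      moreover have "a r \<otimes> b q = a q" for q
      proof -
        have "f r \<otimes> (inv (f r) \<otimes> f q) = f q" using fc by (simp flip: m_assoc)
        then show ?thesis unfolding a_def b_def using fc by (simp add: m_assoc)
      qed
      moreover have "D 0 = 0" using linear_0[OF has_derivative_linear[OF D]] .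
      ultimately show ?thesis by (simp add: has_derivative_at_withinI)
    qed
    have "f q = f p" if q: "q \<in> ball p e" for q
    proof -
      have "\<phi> (a q) = \<phi> (a p)"
        using D q e(1) by (intro has_derivative_zero_unique[OF convex_ball, of p e "\<lambda>q. \<phi> (a q)" q p]) auto
      moreover have "a q \<in> chart_dom c" "a p \<in> chart_dom c"
        using e q \<open>p \<in> V\<close> unfolding V_def by auto
      ultimately have "a q = a p" using chart_inv_fun[OF chart] by metis
      then show ?thesis unfolding a_def using fc by (metis inv_closed Units_eq Units_l_cancel)
    qed
    then show ?thesis unfolding eventually_at using e(1) by (metis dist_commute mem_ball)
  qed
  then show ?thesis
    by (intro connected_local_const[of UNIV p q f]) (auto simp: connected_UNIV)
qed

text \<open>The quotient of the two maps has logarithmic derivative 0 and equals the identity at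
  \<open>p0\<close>.\<close>

lemma log_derivative_unique_map:
  fixes f g :: "'e::real_normed_vector \<Rightarrow> 'g"
  assumes f: "smooth_into_on T A UNIV f" and g: "smooth_into_on T A UNIV g"
    and "\<And>p. has_log_derivative f p (L p)" "\<And>p. has_log_derivative g p (L p)"
    and p0: "f p0 = g p0"
  shows "f p = g p"
proof -
  note c = smooth_carrier[OF f, OF UNIV_I] smooth_carrier[OF g, OF UNIV_I]
  have "has_log_derivative (\<lambda>q. f q \<otimes> inv (g q)) p (\<lambda>h. 0)" for p
    using has_log_derivative_quotient[OF f g UNIV_I assms(3,4), of p]
      linear_0[OF bounded_linear.linear[OF Ad_bounded_linear[OF c(2)]]] by simp
  from log_derivative_zero_imp_constant[OF smooth_mult[OF f smooth_inv[OF g]] this, of p p0]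
  have "f p \<otimes> inv (g p) = \<one>" using p0 c by simp
  then show ?thesis using c inv_equality[of "f p" "inv (g p)"] by simp
qed

section \<open>The Lie bracket as mixed second derivative of conjugation\<close>

definition conj_chart :: "(complex ^ 'n) \<times> (complex ^ 'n) \<Rightarrow> complex ^ 'n" where
  "conj_chart p = \<phi> (chart_inv c (fst p) \<otimes> chart_inv c (snd p) \<otimes> inv (chart_inv c (fst p)))"

lemma conj_chart_smooth:
  obtains W where "open W" "(o\<^sub>G, o\<^sub>G) \<in> W" "W \<subseteq> chart_img c \<times> chart_img c"
    "smooth_on W conj_chart"
proof
  let ?f = "\<lambda>p. chart_inv c (fst p) \<otimes> chart_inv c (snd p) \<otimes> inv (chart_inv c (fst p))"
  let ?W = "{p \<in> chart_img c \<times> chart_img c. ?f p \<in> chart_dom c}"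
  have op: "open (chart_img c \<times> chart_img c)"
    by (intro open_Times open_chart_img[OF chart])
  have f: "smooth_into_on T A (chart_img c \<times> chart_img c) ?f"
    by (intro smooth_mult smooth_inv smooth_compose[OF smooth_into_on_chart_inv[OF chart] op]
        smooth_on_bounded_linear bounded_linear_fst bounded_linear_snd) auto
  show "open ?W" by (rule open_chart_preimage[OF f])
  show "smooth_on ?W conj_chart" using smooth_on_chart[OF f] unfolding conj_chart_def .
  show "(o\<^sub>G, o\<^sub>G) \<in> ?W" using o_img one_dom by simp
qed auto

text \<open>Rewrites \<open>Ad\<close>, a differential computed separately for each group element,
  as a partial derivative of one jointly smooth map; only so can it be differentiated in
  \<open>z\<close>.\<close>

lemma Ad_eq_conj_chart:
  assumes W: "W \<subseteq> chart_img c \<times> chart_img c" "smooth_on W conj_chart" "(z, o\<^sub>G) \<in> W"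
  shows "Ad G c (chart_inv c z) X = frechet_derivative conj_chart (at (z, o\<^sub>G)) (0, X)"
proof -
  have "((\<lambda>w. conj_chart (z, w)) has_derivative (\<lambda>X. frechet_derivative conj_chart (at (z, o\<^sub>G)) (0, X))) (at o\<^sub>G)"
    by (rule has_derivative_compose[where f = "\<lambda>w. (z, w)", OF _ smooth_on_has_derivative[OF W(2,3)]])
      (auto intro!: derivative_eq_intros)
  moreover have "((\<lambda>w. conj_chart (z, w)) has_derivative Ad G c (chart_inv c z)) (at o\<^sub>G)"
    using Ad_works[OF chart_inv_carrier, of z] W(1,3) by (auto simp: conj_chart_def)
  ultimately show ?thesis using has_derivative_unique by metis
qed

text \<open>Makes the \<open>frechet_derivative\<close> defining the bracket a genuine derivative:
  near the origin \<open>Ad\<close> is a first derivative of the smooth \<open>conj_chart\<close>,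
  hence differentiable again.\<close>

lemma has_derivative_Ad_chart:
  "((\<lambda>z. Ad G c (chart_inv c z) Y) has_derivative (\<lambda>X. lie_bracket G c X Y)) (at o\<^sub>G)"
proof -
  obtain W where W: "open W" "(o\<^sub>G, o\<^sub>G) \<in> W" "W \<subseteq> chart_img c \<times> chart_img c"
    "smooth_on W conj_chart" by (rule conj_chart_smooth)
  have pair: "((\<lambda>z. (z, o\<^sub>G)) has_derivative (\<lambda>X. (X, 0))) (at o\<^sub>G)"
    by (auto intro!: derivative_eq_intros)
  obtain D where "((\<lambda>p. frechet_derivative conj_chart (at p) (0, Y)) has_derivative D) (at (o\<^sub>G, o\<^sub>G))"
    using smooth_on_has_derivative[OF smooth_on_frechet_derivative[OF W(4)] W(2)] by blast
  from has_derivative_compose[OF pair this]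
  have "((\<lambda>z. frechet_derivative conj_chart (at (z, o\<^sub>G)) (0, Y)) has_derivative (\<lambda>X. D (X, 0))) (at o\<^sub>G)" .
  moreover have "open ((\<lambda>z. (z, o\<^sub>G)) -` W)"
    by (intro open_vimage W(1) continuous_intros)
  ultimately have "((\<lambda>z. Ad G c (chart_inv c z) Y) has_derivative (\<lambda>X. D (X, 0))) (at o\<^sub>G)"
    by (rule has_derivative_transform_within_open) (use W Ad_eq_conj_chart in auto)
  then have "(\<lambda>z. Ad G c (chart_inv c z) Y) differentiable (at o\<^sub>G)"
    unfolding differentiable_def by blast
  then show ?thesis unfolding frechet_derivative_works lie_bracket_def .
qed

lemma bounded_linear_lie_bracket_left: "bounded_linear (\<lambda>X. lie_bracket G c X Y)"
  using has_derivative_Ad_chart by (rule has_derivative_bounded_linear)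

text \<open>Every \<open>Ad G c g\<close> is linear, and this linearity passes to the derivative in
  the group element.\<close>

lemma lie_bracket_linear_right: "linear (lie_bracket G c X)"
proof (rule linearI)
  have "((\<lambda>z. Ad G c (chart_inv c z) (Y + Y')) has_derivative
      (\<lambda>X. lie_bracket G c X Y + lie_bracket G c X Y')) (at o\<^sub>G)" for Y Y'
    by (rule has_derivative_transform_within_open[OF
        has_derivative_add[OF has_derivative_Ad_chart[of Y] has_derivative_Ad_chart[of Y']]
        open_chart_img[OF chart] o_img])
      (simp add: linear_add[OF bounded_linear.linear[OF Ad_bounded_linear]] chart_inv_carrier)
  from has_derivative_unique[OF this has_derivative_Ad_chart]
  show "lie_bracket G c X (Y + Y') = lie_bracket G c X Y + lie_bracket G c X Y'" for Y Y' by metis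
  have "((\<lambda>z. Ad G c (chart_inv c z) (r *\<^sub>R Y)) has_derivative
      (\<lambda>X. r *\<^sub>R lie_bracket G c X Y)) (at o\<^sub>G)" for r Y
    by (rule has_derivative_transform_within_open[OF
        has_derivative_scaleR_right[OF has_derivative_Ad_chart[of Y]]
        open_chart_img[OF chart] o_img])
      (simp add: linear_scale[OF bounded_linear.linear[OF Ad_bounded_linear]] chart_inv_carrier)
  from has_derivative_unique[OF this has_derivative_Ad_chart]
  show "lie_bracket G c X (r *\<^sub>R Y) = r *\<^sub>R lie_bracket G c X Y" for r Y by metis
qed

text \<open>In the chart, \<open>C(z, w) = z w z\<^sup>-\<^sup>1\<close> agrees with \<open>w\<close> both for \<open>z = 1\<close> and for \<open>w = z\<close>, and with
  the constant \<open>1\<close> for \<open>w = 1\<close>. By Rolle's theorem \<open>D\<^sub>2 C (tX, \<theta>X) X - X\<close> vanishes for some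
  \<open>0 < \<theta> < t\<close> (in each coordinate); its first-order term is \<open>t [X, X]\<close>.\<close>

lemma lie_bracket_self [simp]: "lie_bracket G c X X = 0"
proof -
  obtain W where W: "open W" "(o\<^sub>G, o\<^sub>G) \<in> W" "W \<subseteq> chart_img c \<times> chart_img c"
    "smooth_on W conj_chart" by (rule conj_chart_smooth)
  obtain d where d: "d > 0" "ball (o\<^sub>G, o\<^sub>G) d \<subseteq> W" using W(1,2) openE by blast
  \<comment> \<open>Twice the norm of \<open>X\<close> bounds the pair in units of \<open>t\<close>;
    the added 1 keeps \<open>N\<close> positive when \<open>X = 0\<close>.\<close>
  define N where "N = norm X + norm X + 1"
  have N: "N > 0" unfolding N_def by (simp add: add_nonneg_pos)
  have W_near: "(o\<^sub>G + t *\<^sub>R X, o\<^sub>G + r *\<^sub>R X) \<in> W \<and>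
      norm ((o\<^sub>G + t *\<^sub>R X, o\<^sub>G + r *\<^sub>R X) - (o\<^sub>G, o\<^sub>G)) \<le> t * N"
    if "0 \<le> r" "r \<le> t" "t < d / N" for r t
  proof -
    have "norm (t *\<^sub>R X, r *\<^sub>R X) \<le> norm (t *\<^sub>R X) + norm (r *\<^sub>R X)" by (rule norm_Pair_le)
    also have "\<dots> \<le> t * norm X + t * norm X" using that by (auto intro: mult_right_mono)
    also have "\<dots> \<le> t * N" unfolding N_def using that by (simp add: algebra_simps)
    finally have n: "norm (t *\<^sub>R X, r *\<^sub>R X) \<le> t * N" .
    moreover have "t * N < d" using that(3) N by (simp add: field_simps)
    ultimately have "(o\<^sub>G + t *\<^sub>R X, o\<^sub>G + r *\<^sub>R X) \<in> ball (o\<^sub>G, o\<^sub>G) d"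
      by (simp add: dist_norm norm_Pair)
    then show ?thesis using d(2) n by auto
  qed
  define C where "C p = frechet_derivative conj_chart (at p) (0, X)" for p
  obtain D where D: "(C has_derivative D) (at (o\<^sub>G, o\<^sub>G))"
    using smooth_on_has_derivative[OF smooth_on_frechet_derivative[OF W(4)] W(2)]
    unfolding C_def by blast
  have lin: "linear D" by (rule has_derivative_linear[OF D])
  \<comment> \<open>\<open>C (z, o\<^sub>G)\<close> is \<open>Ad\<close> of the group element at
    \<open>z\<close> applied to \<open>X\<close>, so the first partial derivative of
    \<open>C\<close> at the origin is the bracket with \<open>X\<close> on the right.\<close>
  have "((\<lambda>z. (z, o\<^sub>G)) has_derivative (\<lambda>X. (X, 0))) (at o\<^sub>G)"
    by (auto intro!: derivative_eq_intros)
  from has_derivative_compose[OF this D]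
  have "((\<lambda>z. C (z, o\<^sub>G)) has_derivative (\<lambda>Y. D (Y, 0))) (at o\<^sub>G)" .
  moreover have "open ((\<lambda>z. (z, o\<^sub>G)) -` W)"
    by (intro open_vimage W(1) continuous_intros)
  ultimately have "((\<lambda>z. Ad G c (chart_inv c z) X) has_derivative (\<lambda>Y. D (Y, 0))) (at o\<^sub>G)"
    by (rule has_derivative_transform_within_open)
      (use W(2) Ad_eq_conj_chart[OF W(3,4)] in \<open>auto simp: C_def\<close>)
  from has_derivative_unique[OF this has_derivative_Ad_chart]
  have D1: "D (Y, 0) = lie_bracket G c Y X" for Y by metis
  have op2: "open ((\<lambda>w. (o\<^sub>G, w)) -` W)"
    by (intro open_vimage W(1) continuous_intros)
  have pair2: "((\<lambda>w. (z, w)) has_derivative (\<lambda>Y. (0, Y))) (at w)" for z w :: "complex ^ 'n"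
    by (auto intro!: derivative_eq_intros)
  \<comment> \<open>Conjugation by the identity is the identity map, so
    \<open>C (o\<^sub>G, w)\<close> does not depend on \<open>w\<close>; hence the second partial
    derivative of \<open>C\<close> vanishes in \<open>D2\<close>.\<close>
  have CX: "C (o\<^sub>G, w) = X" if w: "(o\<^sub>G, w) \<in> W" for w
  proof -
    have "((\<lambda>w. conj_chart (o\<^sub>G, w)) has_derivative (\<lambda>X. frechet_derivative conj_chart (at (o\<^sub>G, w)) (0, X))) (at w)"
      by (rule has_derivative_compose[OF pair2 smooth_on_has_derivative[OF W(4) w]])
    then have "((\<lambda>w. w) has_derivative (\<lambda>X. frechet_derivative conj_chart (at (o\<^sub>G, w)) (0, X))) (at w)"
      by (rule has_derivative_transform_within_open[OF _ op2])
        (use W(3) w in \<open>auto simp: conj_chart_def chart_inv_carrier chart_fun_inv subset_iff\<close>)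
    from has_derivative_unique[OF this has_derivative_ident] show ?thesis unfolding C_def by metis
  qed
  have "((\<lambda>w. C (o\<^sub>G, w)) has_derivative (\<lambda>Y. D (0, Y))) (at o\<^sub>G)"
    by (rule has_derivative_compose[OF pair2 D])
  then have "((\<lambda>w. X) has_derivative (\<lambda>Y. D (0, Y))) (at o\<^sub>G)"
    by (rule has_derivative_transform_within_open[OF _ op2]) (use W(2) CX in auto)
  from has_derivative_unique[OF this has_derivative_const] have D2: "D (0, Y) = 0" for Y by metis
  have "lie_bracket G c X X \<bullet> b = 0" for b
  proof (rule ccontr)
    assume nz: "lie_bracket G c X X \<bullet> b \<noteq> 0"
    define B where "B = \<bar>lie_bracket G c X X \<bullet> b\<bar>"
    \<comment> \<open>Chosen so that the approximation error \<open>e * (t * N) * norm b\<close>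
      stays below \<open>t * B\<close>; the added 1 makes the inequality strict and avoids division
      by 0.\<close>
    define e where "e = B / (2 * N * (norm b + 1))"
    have B: "B > 0" using nz by (simp add: B_def)
    have e: "e > 0" unfolding e_def using B N by (simp add: add_nonneg_pos)
    obtain d' where d': "d' > 0" "\<And>p. norm (p - (o\<^sub>G, o\<^sub>G)) < d' \<Longrightarrow>
        norm (C p - C (o\<^sub>G, o\<^sub>G) - D (p - (o\<^sub>G, o\<^sub>G))) \<le> e * norm (p - (o\<^sub>G, o\<^sub>G))"
      using D e unfolding has_derivative_at_alt by blast
    \<comment> \<open>The factor 2 gives strict room both in the ball of radius \<open>d\<close>,
      where \<open>conj_chart\<close> is smooth, and in that of radius \<open>d'\<close>, where
      \<open>D\<close> approximates \<open>C\<close>.\<close>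
    define t where "t = min d d' / (2 * N)"
    have t: "t > 0" "t < d / N" "t * N < d'"
      using d(1) d'(1) N by (auto simp: t_def field_simps min_def)
    define F where "F r = (conj_chart (o\<^sub>G + t *\<^sub>R X, o\<^sub>G + r *\<^sub>R X) - (o\<^sub>G + r *\<^sub>R X)) \<bullet> b" for r
    have F': "(F has_real_derivative (C (o\<^sub>G + t *\<^sub>R X, o\<^sub>G + r *\<^sub>R X) - X) \<bullet> b) (at r)"
      if r: "0 \<le> r" "r \<le> t" for r
    proof -
      have "((\<lambda>r. (o\<^sub>G + t *\<^sub>R X, o\<^sub>G + r *\<^sub>R X)) has_derivative (\<lambda>h. h *\<^sub>R (0, X))) (at r)"
        by (auto intro!: derivative_eq_intros)
      from has_derivative_compose[OF this smooth_on_has_derivative[OF W(4)]]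
      have *: "((\<lambda>r. conj_chart (o\<^sub>G + t *\<^sub>R X, o\<^sub>G + r *\<^sub>R X)) has_derivative
          (\<lambda>h. frechet_derivative conj_chart (at (o\<^sub>G + t *\<^sub>R X, o\<^sub>G + r *\<^sub>R X)) (h *\<^sub>R (0, X)))) (at r)"
        using W_near[OF r t(2)] by blast
      have "linear (frechet_derivative conj_chart (at (o\<^sub>G + t *\<^sub>R X, o\<^sub>G + r *\<^sub>R X)))"
        using has_derivative_linear smooth_on_has_derivative[OF W(4)] W_near[OF r t(2)] by blast
      then have "((\<lambda>r. conj_chart (o\<^sub>G + t *\<^sub>R X, o\<^sub>G + r *\<^sub>R X)) has_derivative
          (\<lambda>h. h *\<^sub>R C (o\<^sub>G + t *\<^sub>R X, o\<^sub>G + r *\<^sub>R X))) (at r)"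
        using * by (simp only: linear_scale C_def)
      then show ?thesis unfolding F_def has_field_derivative_def
        by (auto intro!: derivative_eq_intros simp: inner_diff_left algebra_simps)
    qed
    have in_img: "o\<^sub>G + t *\<^sub>R X \<in> chart_img c"
      using W_near[of t t] t W(3) by auto
    have "F 0 = 0" "F t = 0"
      unfolding F_def conj_chart_def using in_img
      by (simp_all add: chart_inv_carrier chart_fun_inv m_assoc)
    then obtain r where r: "0 < r" "r < t" "(C (o\<^sub>G + t *\<^sub>R X, o\<^sub>G + r *\<^sub>R X) - X) \<bullet> b = 0"
      using MVT2[of 0 t F, OF t(1) F'] t(1) by auto
    define p where "p = (o\<^sub>G + t *\<^sub>R X, o\<^sub>G + r *\<^sub>R X)"
    have np: "norm (p - (o\<^sub>G, o\<^sub>G)) \<le> t * N"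
      using W_near[of r t] r t(2) unfolding p_def by simp
    have "D (p - (o\<^sub>G, o\<^sub>G)) = D (t *\<^sub>R (X, 0) + r *\<^sub>R (0, X))" by (simp add: p_def)
    also have "\<dots> = t *\<^sub>R lie_bracket G c X X"
      by (simp only: linear_add[OF lin] linear_scale[OF lin] D1 D2) simp
    finally have Dp: "D (p - (o\<^sub>G, o\<^sub>G)) = t *\<^sub>R lie_bracket G c X X" .
    \<comment> \<open>At the Rolle point \<open>C p\<close> and
      \<open>C (o\<^sub>G, o\<^sub>G) = X\<close> have the same component along \<open>b\<close>, so
      only the linear term survives.\<close>
    have "t * B = \<bar>(C p - C (o\<^sub>G, o\<^sub>G) - D (p - (o\<^sub>G, o\<^sub>G))) \<bullet> b\<bar>"
      using r(3) CX[OF W(2)] t(1) unfolding Dp B_def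
      by (simp add: inner_diff_left abs_mult p_def[symmetric])
    also have "\<dots> \<le> norm (C p - C (o\<^sub>G, o\<^sub>G) - D (p - (o\<^sub>G, o\<^sub>G))) * norm b"
      by (rule Cauchy_Schwarz_ineq2)
    also have "\<dots> \<le> (e * (t * N)) * norm b"
    proof (rule mult_right_mono)
      have "norm (C p - C (o\<^sub>G, o\<^sub>G) - D (p - (o\<^sub>G, o\<^sub>G))) \<le> e * norm (p - (o\<^sub>G, o\<^sub>G))"
        using d'(2)[of p] np t(3) by linarith
      also have "\<dots> \<le> e * (t * N)" using np e by (intro mult_left_mono) auto
      finally show "norm (C p - C (o\<^sub>G, o\<^sub>G) - D (p - (o\<^sub>G, o\<^sub>G))) \<le> e * (t * N)" .
    qed simp
    also have "\<dots> = t * B * (norm b / (2 * (norm b + 1)))"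
      unfolding e_def using N norm_ge_zero[of b] by (simp add: divide_simps)
    also have "\<dots> < t * B * 1"
      using t(1) B by (intro mult_strict_left_mono) (auto simp: divide_less_eq add_nonneg_pos)
    finally show False by simp
  qed
  then show ?thesis using inner_eq_zero_iff by blast
qed

text \<open>Writing \<open>f q = f p \<otimes> a q\<close> splits off the constant factor
  \<open>Ad G c (f p)\<close>. At \<open>p\<close> the remaining \<open>a\<close> is the identity,
  where \<open>Ad\<close> has the bracket as derivative, and the product rule adds
  \<open>Y'\<close>.\<close>

lemma has_derivative_Ad:
  assumes f: "smooth_into_on T A S f" "p \<in> S" and L: "has_log_derivative f p L"
    and Y: "(Y has_derivative Y') (at p)"
  shows "((\<lambda>q. Ad G c (f q) (Y q)) has_derivative
    (\<lambda>h. Ad G c (f p) (lie_bracket G c (L h) (Y p) + Y' h))) (at p)"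
proof -
  define a where "a q = inv (f p) \<otimes> f q" for q
  note fc = smooth_carrier[OF f(1)]
  have a: "smooth_into_on T A S a" and ap: "a p = \<one>"
    unfolding a_def using smooth_left_translate[OF f] fc f(2) by auto
  have ac: "a q \<in> carrier G" if "q \<in> S" for q using smooth_carrier[OF a that] .
  have lin: "linear (Ad G c g)" if "g \<in> carrier G" for g
    using Ad_bounded_linear[OF that] by (rule bounded_linear.linear)
  \<comment> \<open>The derivative of \<open>Ad\<close> is available for a fixed vector only; in
    coordinates the varying \<open>Y q\<close> becomes scalar functions times fixed basis
    vectors.\<close>
  have expand: "M Z = (\<Sum>b\<in>Basis. (Z \<bullet> b) *\<^sub>R M b)" if "linear M"
    for M :: "complex ^ 'n \<Rightarrow> complex ^ 'n" and Z
    by (subst euclidean_representation[of Z, symmetric])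
      (simp only: linear_sum[OF that] linear_scale[OF that])
  have Ad_a: "((\<lambda>q. Ad G c (a q) b) has_derivative (\<lambda>h. lie_bracket G c (L h) b)) (at p)" for b
    using chart_has_derivative_compose[OF a f(2) _ _, of L "\<lambda>x. Ad G c x b"]
      has_derivative_Ad_chart[of b] L ap one_dom unfolding has_log_derivative_def a_def by simp
  have "((\<lambda>q. \<Sum>b\<in>Basis. (Y q \<bullet> b) *\<^sub>R Ad G c (a q) b) has_derivative
      (\<lambda>h. \<Sum>b\<in>Basis. (Y p \<bullet> b) *\<^sub>R lie_bracket G c (L h) b + (Y' h \<bullet> b) *\<^sub>R Ad G c (a p) b)) (at p)"
    by (intro has_derivative_sum has_derivative_scaleR Ad_a has_derivative_inner_left Y)
  then have "((\<lambda>q. \<Sum>b\<in>Basis. (Y q \<bullet> b) *\<^sub>R Ad G c (a q) b) has_derivative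
      (\<lambda>h. lie_bracket G c (L h) (Y p) + Y' h)) (at p)"
    by (simp add: sum.distrib ap Ad_one euclidean_representation flip: expand[OF lie_bracket_linear_right])
  from bounded_linear.has_derivative[OF Ad_bounded_linear[OF fc[OF f(2)]] this]
  show ?thesis
    by (rule has_derivative_transform_within_open[OF _ smooth_into_on_open[OF f(1)] f(2)])
      (simp add: ac fc f(2) flip: expand[OF lin] Ad_mult, simp add: a_def fc f(2) flip: m_assoc)
qed

end

section \<open>The flow and its wave map\<close>

lemma has_vector_derivative_compose_has_derivative:
  assumes "(\<gamma> has_vector_derivative w) (at t)" "(f has_derivative D) (at (\<gamma> t))"
  shows "((\<lambda>r. f (\<gamma> r)) has_vector_derivative D w) (at t)"
  using has_derivative_compose[OF assms[unfolded has_vector_derivative_def]]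
    linear_scale[OF has_derivative_linear[OF assms(2)]]
  by (simp add: has_vector_derivative_def)

text \<open>The flow equations are about partial derivatives, whereas differentiating along the
  lines of constant \<open>x\<close> or \<open>t\<close> takes a total derivative.\<close>

lemma smooth_on_pair_derivative:
  fixes f :: "real \<Rightarrow> real \<Rightarrow> 'b::real_normed_vector"
  assumes "smooth_on UNIV (\<lambda>(\<xi>, \<eta>). f \<xi> \<eta>)"
  obtains D where "((\<lambda>(\<xi>, \<eta>). f \<xi> \<eta>) has_derivative D) (at (\<xi>, \<eta>))"
    "D (1, 0) = vector_derivative (\<lambda>r. f r \<eta>) (at \<xi>)"
    "D (0, 1) = vector_derivative (\<lambda>r. f \<xi> r) (at \<eta>)"
proof -
  obtain D where D: "((\<lambda>(\<xi>, \<eta>). f \<xi> \<eta>) has_derivative D) (at (\<xi>, \<eta>))"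
    using smooth_on_has_derivative[OF assms] by blast
  have "((\<lambda>r. (r, \<eta>)) has_vector_derivative (1, 0)) (at \<xi>)"
    "((\<lambda>r. (\<xi>, r)) has_vector_derivative (0, 1)) (at \<eta>)"
    unfolding has_vector_derivative_def by (auto intro!: derivative_eq_intros)
  from this[THEN has_vector_derivative_compose_has_derivative, OF D] show thesis
    by (intro that[OF D]) (simp_all add: vector_derivative_at)
qed

context lie_group_chart
begin

lemma left_log_deriv_compose:
  assumes "(\<gamma> has_vector_derivative w) (at t)" "has_log_derivative f p L" "\<gamma> t = p"
  shows "left_log_deriv G c (\<lambda>r. f (\<gamma> r)) t = L w"
  unfolding left_log_deriv_def
  using has_vector_derivative_compose_has_derivative[OF assms(1), of _ L] assms(2,3)
  unfolding has_log_derivative_def by (auto intro: vector_derivative_at)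

lemma trivialization_smooth:
  "trivialization G T A c a u v E \<Longrightarrow> z \<noteq> 0 \<Longrightarrow> smooth_into_on T A UNIV (\<lambda>(\<xi>, \<eta>). E \<xi> \<eta> z)"
  unfolding trivialization_def smooth_into_iff_on by blast

text \<open>The Lax pair prescribes only the two partial logarithmic derivatives. Smoothness yields
  a total one, and linearity determines it from its values on \<open>(1, 0)\<close> and
  \<open>(0, 1)\<close>.\<close>

lemma trivialization_has_log_derivative:
  assumes E: "trivialization G T A c a u v E" and z: "z \<noteq> 0"
  shows "has_log_derivative (\<lambda>(\<xi>, \<eta>). E \<xi> \<eta> z) (\<xi>, \<eta>)
    (\<lambda>(h, k). h *\<^sub>R (z *s a \<xi> \<eta> + u \<xi> \<eta>) + k *\<^sub>R (inverse z *s v \<xi> \<eta>))"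
proof -
  obtain L where L: "has_log_derivative (\<lambda>(\<xi>, \<eta>). E \<xi> \<eta> z) (\<xi>, \<eta>) L"
    using ex_log_derivative[OF trivialization_smooth[OF E z] UNIV_I] by blast
  have lin: "linear L" using L unfolding has_log_derivative_def by (rule has_derivative_linear)
  have "((\<lambda>r. (r, \<eta>)) has_vector_derivative (1, 0)) (at \<xi>)"
    "((\<lambda>r. (\<xi>, r)) has_vector_derivative (0, 1)) (at \<eta>)"
    unfolding has_vector_derivative_def by (auto intro!: derivative_eq_intros)
  from this[THEN left_log_deriv_compose, OF L]
  have "L (1, 0) = z *s a \<xi> \<eta> + u \<xi> \<eta>" "L (0, 1) = inverse z *s v \<xi> \<eta>"
    using E z unfolding trivialization_def by simp_all
  moreover have "L (h, k) = h *\<^sub>R L (1, 0) + k *\<^sub>R L (0, 1)" for h k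
    by (simp flip: linear_add[OF lin] linear_scale[OF lin])
  ultimately have "L (h, k) = h *\<^sub>R (z *s a \<xi> \<eta> + u \<xi> \<eta>) + k *\<^sub>R (inverse z *s v \<xi> \<eta>)" for h k
    by metis
  then have "L = (\<lambda>(h, k). h *\<^sub>R (z *s a \<xi> \<eta> + u \<xi> \<eta>) + k *\<^sub>R (inverse z *s v \<xi> \<eta>))"
    by (simp add: fun_eq_iff)
  with L show ?thesis by simp
qed

text \<open>A curve in the fixed point set is unchanged by \<open>F\<close>, and so is its velocity
  at the identity.\<close>

lemma differential_fixes_lie_algebra:
  assumes "smooth_self_map T A F" "F \<one> = \<one>" "X \<in> lie_algebra_of G T A c (fixed_in H F)"
  shows "differential_at_one G c F X = X"
proof -
  obtain \<gamma> where \<gamma>: "smooth_into_on T A UNIV \<gamma>" "range \<gamma> \<subseteq> fixed_in H F" "\<gamma> 0 = \<one>"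
    "((\<lambda>t. \<phi> (\<gamma> t)) has_derivative (\<lambda>h. h *\<^sub>R X)) (at 0)"
    using assms(3) unfolding lie_algebra_of_def smooth_into_iff_on has_vector_derivative_def comp_def
    by blast
  have "((\<lambda>t. \<phi> (F (\<gamma> t))) has_derivative (\<lambda>h. differential_at_one G c F (h *\<^sub>R X))) (at 0)"
    using chart_has_derivative_compose[OF \<gamma>(1) UNIV_I _ \<gamma>(4), of "\<lambda>g. \<phi> (F g)"]
      self_map_differential[OF assms(1,2)] \<gamma>(3) one_dom by simp
  moreover have "F (\<gamma> t) = \<gamma> t" for t using \<gamma>(2) by (auto simp: fixed_in_def)
  ultimately have "(\<lambda>h. differential_at_one G c F (h *\<^sub>R X)) = (\<lambda>h. h *\<^sub>R X)"
    using has_derivative_unique[OF _ \<gamma>(4)] by simp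
  then show ?thesis by (metis scaleR_one)
qed

text \<open>With \<open>g = E(\<cdot>, \<cdot>, 1)\<close>, the quotient rule gives \<open>s\<^sup>-\<^sup>1 s\<^sub>\<xi> = - 2 Ad(g) a\<close> and
  \<open>s\<^sup>-\<^sup>1 s\<^sub>\<eta> = - 2 Ad(g) v\<close>.\<close>

lemma minus_one_flow_wave_equation:
  assumes flow: "minus_one_flow G c \<U> a u v" and E: "trivialization G T A c a u v E"
  defines "s \<equiv> \<lambda>x t. E ((x + t) / 2) ((x - t) / 2) (- 1) \<otimes> inv (E ((x + t) / 2) ((x - t) / 2) 1)"
  shows "vector_derivative (\<lambda>t'. left_log_deriv G c (\<lambda>r. s x r) t') (at t) =
    vector_derivative (\<lambda>x'. left_log_deriv G c (\<lambda>r. s r t) x') (at x)"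
proof -
  define e where "e = (\<lambda>(\<xi>, \<eta>). E \<xi> \<eta> 1)"
  define S where "S = (\<lambda>p. (\<lambda>(\<xi>, \<eta>). E \<xi> \<eta> (-1)) p \<otimes> inv (e p))"
  define a2 where "a2 = (\<lambda>(\<xi>, \<eta>). a \<xi> \<eta>)"
  define v2 where "v2 = (\<lambda>(\<xi>, \<eta>). v \<xi> \<eta>)"
  have e_smooth: "smooth_into_on T A UNIV e"
    unfolding e_def using trivialization_smooth[OF E, of 1] by simp
  have e: "has_log_derivative e (\<xi>, \<eta>) (\<lambda>(h, k). h *\<^sub>R (a \<xi> \<eta> + u \<xi> \<eta>) + k *\<^sub>R v \<xi> \<eta>)" for \<xi> \<eta>
    unfolding e_def using trivialization_has_log_derivative[OF E, of 1] by simp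
  have S: "has_log_derivative S p (\<lambda>(h, k). Ad G c (e p) (- 2 *\<^sub>R (h *\<^sub>R a2 p + k *\<^sub>R v2 p)))" for p
  proof (cases p)
    case (Pair \<xi> \<eta>)
    \<comment> \<open>Between the parameters -1 and 1 the terms in \<open>u\<close> cancel, while
      those in \<open>a\<close> and \<open>v\<close> double.\<close>
    have "((\<lambda>(h, k). h *\<^sub>R (- 1 *s a \<xi> \<eta> + u \<xi> \<eta>) + k *\<^sub>R (inverse (- 1) *s v \<xi> \<eta>)) h -
        (\<lambda>(h, k). h *\<^sub>R (a \<xi> \<eta> + u \<xi> \<eta>) + k *\<^sub>R v \<xi> \<eta>) h) =
        (\<lambda>(h, k). - 2 *\<^sub>R (h *\<^sub>R a \<xi> \<eta> + k *\<^sub>R v \<xi> \<eta>)) h" for h :: "real \<times> real"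
      by (simp add: case_prod_unfold vec_eq_iff complex_eq_iff algebra_simps)
    then show ?thesis
      using has_log_derivative_quotient[OF trivialization_smooth[OF E, of "-1"] e_smooth UNIV_I
          trivialization_has_log_derivative[OF E, of "-1"] e, of \<xi> \<eta>]
      unfolding S_def a2_def v2_def Pair by (simp add: case_prod_unfold)
  qed
  have lin_br: "linear (\<lambda>X. lie_bracket G c X Y)" for Y
    using bounded_linear.linear[OF bounded_linear_lie_bracket_left] .
  have line_t: "((\<lambda>r. ((x + r) / 2, (x - r) / 2)) has_vector_derivative (1/2, -1/2)) (at t)" for x t :: real
    unfolding has_vector_derivative_def by (auto intro!: derivative_eq_intros)
  have line_x: "((\<lambda>r. ((r + t) / 2, (r - t) / 2)) has_vector_derivative (1/2, 1/2)) (at x)" for x t :: real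
    unfolding has_vector_derivative_def by (auto intro!: derivative_eq_intros)
  have s_eq: "s x t = S ((x + t) / 2, (x - t) / 2)" for x t
    by (simp add: s_def S_def e_def)
  have half: "- 2 *\<^sub>R ((1/2) *\<^sub>R x + (-1/2) *\<^sub>R y) = y - x"
    "- 2 *\<^sub>R ((1/2) *\<^sub>R x + (1/2) *\<^sub>R y) = - y - x" for x y :: "complex ^ 'n"
    by (simp_all add: vec_eq_iff complex_eq_iff algebra_simps)
  have lt: "left_log_deriv G c (\<lambda>r. s x r) t =
      (\<lambda>p. Ad G c (e p) (v2 p - a2 p)) ((x + t) / 2, (x - t) / 2)" for x t
    unfolding s_eq using left_log_deriv_compose[OF line_t S refl, of x t]
    by (simp only: prod.case half)
  have lx: "left_log_deriv G c (\<lambda>r. s r t) x =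
      (\<lambda>p. Ad G c (e p) (- v2 p - a2 p)) ((x + t) / 2, (x - t) / 2)" for x t
    unfolding s_eq using left_log_deriv_compose[OF line_x S refl, of t x]
    by (simp only: prod.case half)
  define \<xi> where "\<xi> = (x + t) / 2"
  define \<eta> where "\<eta> = (x - t) / 2"
  have flow': "smooth_on UNIV (\<lambda>(\<xi>, \<eta>). a \<xi> \<eta>)" "smooth_on UNIV (\<lambda>(\<xi>, \<eta>). v \<xi> \<eta>)"
    "vector_derivative (\<lambda>r. a \<xi> r) (at \<eta>) = 0"
    "vector_derivative (\<lambda>r. v r \<eta>) (at \<xi>) = - lie_bracket G c (u \<xi> \<eta>) (v \<xi> \<eta>)"
    using flow unfolding minus_one_flow_def by blast+
  obtain a' where a': "(a2 has_derivative a') (at (\<xi>, \<eta>))" "a' (0, 1) = 0"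
    using smooth_on_pair_derivative[OF flow'(1), of \<xi> \<eta>] flow'(3) unfolding a2_def by metis
  obtain v' where v': "(v2 has_derivative v') (at (\<xi>, \<eta>))" "v' (1, 0) = - lie_bracket G c (u \<xi> \<eta>) (v \<xi> \<eta>)"
    using smooth_on_pair_derivative[OF flow'(2), of \<xi> \<eta>] flow'(4) unfolding v2_def by metis
  note la = has_derivative_linear[OF a'(1)] and lv = has_derivative_linear[OF v'(1)]
  let ?a = "a \<xi> \<eta>" and ?u = "u \<xi> \<eta>" and ?v = "v \<xi> \<eta>"
  have "vector_derivative (\<lambda>t'. left_log_deriv G c (\<lambda>r. s x r) t') (at t) =
      Ad G c (e (\<xi>, \<eta>)) (lie_bracket G c ((1/2) *\<^sub>R (?a + ?u) + (-1/2) *\<^sub>R ?v) (?v - ?a) +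
        (v' (1/2, -1/2) - a' (1/2, -1/2)))"
    unfolding lt
    using vector_derivative_at[OF has_vector_derivative_compose_has_derivative[OF line_t
          has_derivative_Ad[OF e_smooth UNIV_I e has_derivative_diff[OF v'(1) a'(1)], unfolded \<xi>_def \<eta>_def]]]
    by (simp add: \<xi>_def \<eta>_def a2_def v2_def)
  moreover have "vector_derivative (\<lambda>x'. left_log_deriv G c (\<lambda>r. s r t) x') (at x) =
      Ad G c (e (\<xi>, \<eta>)) (lie_bracket G c ((1/2) *\<^sub>R (?a + ?u) + (1/2) *\<^sub>R ?v) (- ?v - ?a) +
        (- v' (1/2, 1/2) - a' (1/2, 1/2)))"
    unfolding lx
    using vector_derivative_at[OF has_vector_derivative_compose_has_derivative[OF line_x
          has_derivative_Ad[OF e_smooth UNIV_I e has_derivative_diff[OF has_derivative_minus[OF v'(1)] a'(1)],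
            unfolded \<xi>_def \<eta>_def]]]
    by (simp add: \<xi>_def \<eta>_def a2_def v2_def)
  \<comment> \<open>Here and in the next bracket the left argument is half of \<open>u\<close> minus
    half of the right argument, so \<open>lie_bracket_self\<close> leaves only the bracket with
    \<open>u\<close>.\<close>
  moreover have "lie_bracket G c ((1/2) *\<^sub>R (?a + ?u) + (-1/2) *\<^sub>R ?v) (?v - ?a) =
      (1/2) *\<^sub>R lie_bracket G c ?u (?v - ?a)"
  proof -
    have "(1/2) *\<^sub>R (?a + ?u) + (-1/2) *\<^sub>R ?v = (1/2) *\<^sub>R ?u + (-1/2) *\<^sub>R (?v - ?a)"
      by (simp add: vec_eq_iff complex_eq_iff algebra_simps)
    then show ?thesis by (simp only: linear_add[OF lin_br] linear_scale[OF lin_br]) simp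
  qed
  moreover have "lie_bracket G c ((1/2) *\<^sub>R (?a + ?u) + (1/2) *\<^sub>R ?v) (- ?v - ?a) =
      (1/2) *\<^sub>R lie_bracket G c ?u (- ?v - ?a)"
  proof -
    have "(1/2) *\<^sub>R (?a + ?u) + (1/2) *\<^sub>R ?v = (1/2) *\<^sub>R ?u + (-1/2) *\<^sub>R (- ?v - ?a)"
      by (simp add: vec_eq_iff complex_eq_iff algebra_simps)
    then show ?thesis by (simp only: linear_add[OF lin_br] linear_scale[OF lin_br]) simp
  qed
  moreover have "D (h, k) = h *\<^sub>R D (1, 0) + k *\<^sub>R D (0, 1)" if "linear D"
    for D :: "real \<times> real \<Rightarrow> complex ^ 'n" and h k
    by (simp flip: linear_add[OF that] linear_scale[OF that])
  note expand = this[OF la] this[OF lv]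
  \<comment> \<open>By the flow equations the derivative of \<open>v\<close> in \<xi> cancels the
    bracket of \<open>u\<close> and \<open>v\<close>, and both sides become minus half of the sum of
    [u, a], the \<eta>-derivative of \<open>v\<close> and the \<xi>-derivative of
    \<open>a\<close>.\<close>
  have "(1/2) *\<^sub>R lie_bracket G c ?u (?v - ?a) + (v' (1/2, -1/2) - a' (1/2, -1/2)) =
      (1/2) *\<^sub>R lie_bracket G c ?u (- ?v - ?a) + (- v' (1/2, 1/2) - a' (1/2, 1/2))"
    unfolding expand[of "1/2" "1/2"] expand[of "1/2" "-1/2"] a'(2) v'(2)
      linear_diff[OF lie_bracket_linear_right] linear_neg[OF lie_bracket_linear_right]
    by (simp add: vec_eq_iff complex_eq_iff algebra_simps)
  ultimately show ?thesis by simp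
qed

text \<open>The definite description is well defined because an element \<open>k\<close> of
  \<open>K\<close> is fixed by \<sigma> and cancels in
  \<open>(g \<otimes> k) \<otimes> inv (\<sigma> (g \<otimes> k))\<close>.\<close>

lemma cartan_embedding_coset:
  assumes "\<sigma> \<in> hom G G" "U \<subseteq> carrier G" "g \<in> carrier G" "K = fixed_in U \<sigma>" "\<one> \<in> K"
  shows "cartan_embedding G \<sigma> (g <#\<^bsub>G\<^esub> K) = g \<otimes> inv (\<sigma> g)"
  unfolding cartan_embedding_def
proof (rule the_equality)
  interpret \<sigma>: group_hom G G \<sigma> by unfold_locales (rule assms(1))
  show "\<exists>h\<in>g <#\<^bsub>G\<^esub> K. g \<otimes> inv (\<sigma> g) = h \<otimes> inv (\<sigma> h)"
    using assms by (intro bexI[of _ g]) (auto simp: l_coset_def intro!: bexI[of _ \<one>])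
  fix m assume "\<exists>h\<in>g <#\<^bsub>G\<^esub> K. m = h \<otimes> inv (\<sigma> h)"
  then obtain k where k: "k \<in> carrier G" "\<sigma> k = k" "m = (g \<otimes> k) \<otimes> inv (\<sigma> (g \<otimes> k))"
    using assms by (auto simp: l_coset_def fixed_in_def)
  moreover have "k \<otimes> (inv k \<otimes> inv (\<sigma> g)) = inv (\<sigma> g)"
    using k(1) assms(3) by (simp flip: m_assoc)
  ultimately show "m = g \<otimes> inv (\<sigma> g)"
    using assms(3) by (simp add: inv_mult_group m_assoc)
qed

end

section \<open>Symmetries of the trivialization and the lift to U/K\<close>

theorem mainTheorem5:
  fixes G :: "'g monoid" and T :: "'g topology" and A :: "('g, 'n::finite) chart set"
    and c :: "('g, 'n) chart" and \<tau> \<sigma> :: "'g \<Rightarrow> 'g"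
    and U K :: "'g set" and \<U> \<K> \<P> :: "(complex ^ 'n) set"
    and a u v :: "real \<Rightarrow> real \<Rightarrow> complex ^ 'n"
    and E :: "real \<Rightarrow> real \<Rightarrow> complex \<Rightarrow> 'g"
    and s :: "real \<Rightarrow> real \<Rightarrow> 'g"
  assumes "complex_lie_group G T A"
    and "c \<in> A" and "\<one>\<^bsub>G\<^esub> \<in> chart_dom c"
    and "semisimple G c"
    and "lie_involution G T A \<tau>" and "lie_involution G T A \<sigma>"
    and "\<forall>g\<in>carrier G. \<sigma> (\<tau> g) = \<tau> (\<sigma> g)"
    and "conjugate_linear (differential_at_one G c \<tau>)"
    and "complex_linear (differential_at_one G c \<sigma>)"
    and "U = fixed_in (carrier G) \<tau>" and "compactin T U" and "\<sigma> ` U \<subseteq> U"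
    and "K = fixed_in U \<sigma>"
    and "\<U> = lie_algebra_of G T A c U"
    and "\<K> = plus_space (differential_at_one G c \<sigma>) \<U>"
    and "\<P> = minus_space (differential_at_one G c \<sigma>) \<U>"
    and "minus_one_flow G c \<U> a u v"
    and "trivialization G T A c a u v E"
    and "\<forall>\<xi> \<eta>. s \<xi> \<eta> = E \<xi> \<eta> (-1) \<otimes>\<^bsub>G\<^esub> inv\<^bsub>G\<^esub> (E \<xi> \<eta> 1)"
    and "\<forall>\<xi> \<eta>. a \<xi> \<eta> \<in> \<P> \<and> v \<xi> \<eta> \<in> \<P>"
    and "\<forall>\<xi> \<eta>. u \<xi> \<eta> \<in> \<K>"
  shows "(\<forall>\<xi> \<eta>. s \<xi> \<eta> \<in> M_sigma G U \<sigma>) \<and>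
         wave_map_into G T A c U (\<lambda>x t. s ((x + t) / 2) ((x - t) / 2)) \<and>
         (\<exists>f. wave_map_into_symmetric_space G T A c U K \<sigma> f \<and>
           (\<forall>x t. cartan_embedding G \<sigma> (f x t) = s ((x + t) / 2) ((x - t) / 2)))"
proof -
  interpret lie_group_chart G T A c
    using assms(1-3) by unfold_locales
  note flow = assms(17) and E = assms(18)
  have \<tau>: "\<tau> \<in> hom G G" "smooth_self_map T A \<tau>" and \<sigma>: "\<sigma> \<in> hom G G" "smooth_self_map T A \<sigma>"
    using assms(5,6) by (simp_all add: lie_involution_def iso_def)
  interpret \<tau>: group_hom G G \<tau> by unfold_locales (rule \<tau>(1))
  interpret \<sigma>: group_hom G G \<sigma> by unfold_locales (rule \<sigma>(1))
  let ?\<tau> = "differential_at_one G c \<tau>" and ?\<sigma> = "differential_at_one G c \<sigma>"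
  have lin: "linear ?\<tau>" "linear ?\<sigma>"
    using self_map_differential[OF \<tau>(2)] self_map_differential[OF \<sigma>(2)] has_derivative_linear by auto
  let ?L = "\<lambda>z \<xi> \<eta> (h, k). h *\<^sub>R (z *s a \<xi> \<eta> + u \<xi> \<eta>) + k *\<^sub>R (inverse z *s v \<xi> \<eta>)"
  let ?E = "\<lambda>z (\<xi>, \<eta>). E \<xi> \<eta> z"
  have Ec: "E \<xi> \<eta> z \<in> carrier G" if "z \<noteq> 0" for \<xi> \<eta> z
    using smooth_carrier[OF trivialization_smooth[OF E that], of "(\<xi>, \<eta>)"] by simp
  have E0: "E 0 0 z = \<one>\<^bsub>G\<^esub>" if "z \<noteq> 0" for z
    using E that by (simp add: trivialization_def)
  have neg_one: "- 1 *s x = - x" for x :: "complex ^ 'n" by (simp add: vec_eq_iff)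
  have \<tau>_fix: "?\<tau> X = X" if "X \<in> \<U>" for X
    using differential_fixes_lie_algebra[OF \<tau>(2)] that assms(10,14) by simp
  \<comment> \<open>At these two parameters \<open>z\<close> acts as a sign, so \<open>?L\<close> is
    a real combination of vectors fixed by the real linear \<open>?\<tau>\<close>; for non-real
    \<open>z\<close> conjugation would intervene.\<close>
  have \<tau>L: "?\<tau> (?L z \<xi> \<eta> p) = ?L z \<xi> \<eta> p" if "z = 1 \<or> z = - 1" for z \<xi> \<eta> p
  proof -
    have "?\<tau> (a \<xi> \<eta>) = a \<xi> \<eta>" "?\<tau> (u \<xi> \<eta>) = u \<xi> \<eta>" "?\<tau> (v \<xi> \<eta>) = v \<xi> \<eta>"
      using flow \<tau>_fix by (simp_all add: minus_one_flow_def)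
    then show ?thesis using that
      by (cases p) (auto simp: neg_one linear_add[OF lin(1)] linear_scale[OF lin(1)] linear_neg[OF lin(1)])
  qed
  have \<tau>E: "\<tau> (E \<xi> \<eta> z) = E \<xi> \<eta> z" if z: "z = 1 \<or> z = - 1" for z \<xi> \<eta>
  proof -
    have z0: "z \<noteq> 0" using z by auto
    note sm = trivialization_smooth[OF E z0]
    have "(\<lambda>p. \<tau> (?E z p)) (\<xi>, \<eta>) = ?E z (\<xi>, \<eta>)"
    proof (rule log_derivative_unique_map[where L = "\<lambda>(\<xi>, \<eta>). ?L z \<xi> \<eta>" and ?p0.0 = "(0, 0)"])
      show "smooth_into_on T A UNIV (\<lambda>p. \<tau> (?E z p))" by (rule smooth_into_on_self_map[OF \<tau>(2) sm])
      show "smooth_into_on T A UNIV (?E z)" by (rule sm)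
      show "has_log_derivative (?E z) p ((\<lambda>(\<xi>, \<eta>). ?L z \<xi> \<eta>) p)" for p
        using trivialization_has_log_derivative[OF E z0] by (cases p) simp
      show "has_log_derivative (\<lambda>p. \<tau> (?E z p)) p ((\<lambda>(\<xi>, \<eta>). ?L z \<xi> \<eta>) p)" for p
      proof (cases p)
        case (Pair \<xi> \<eta>)
        from has_log_derivative_hom[OF sm UNIV_I trivialization_has_log_derivative[OF E z0] \<tau>(2,1)]
        show ?thesis unfolding Pair \<tau>L[OF z] by simp
      qed
      show "\<tau> (?E z (0, 0)) = ?E z (0, 0)" using E0[OF z0] by simp
    qed
    then show ?thesis by simp
  qed
  have \<sigma>E: "\<sigma> (E \<xi> \<eta> 1) = E \<xi> \<eta> (- 1)" for \<xi> \<eta>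
  proof -
    note sm = trivialization_smooth[OF E, of 1, simplified] trivialization_smooth[OF E, of "-1", simplified]
    have eigen: "?\<sigma> (a \<xi> \<eta>) = - a \<xi> \<eta>" "?\<sigma> (u \<xi> \<eta>) = u \<xi> \<eta>" "?\<sigma> (v \<xi> \<eta>) = - v \<xi> \<eta>" for \<xi> \<eta>
      using assms(15,16,20,21) by (simp_all add: plus_space_def minus_space_def)
    have \<sigma>L: "?\<sigma> (?L 1 \<xi> \<eta> p) = ?L (- 1) \<xi> \<eta> p" for \<xi> \<eta> p
      by (cases p) (simp add: neg_one eigen linear_add[OF lin(2)] linear_scale[OF lin(2)])
    have "(\<lambda>p. \<sigma> (?E 1 p)) (\<xi>, \<eta>) = ?E (- 1) (\<xi>, \<eta>)"
    proof (rule log_derivative_unique_map[where L = "\<lambda>(\<xi>, \<eta>). ?L (- 1) \<xi> \<eta>" and ?p0.0 = "(0, 0)"])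
      show "smooth_into_on T A UNIV (\<lambda>p. \<sigma> (?E 1 p))" by (rule smooth_into_on_self_map[OF \<sigma>(2) sm(1)])
      show "smooth_into_on T A UNIV (?E (- 1))" by (rule sm(2))
      show "has_log_derivative (?E (- 1)) p ((\<lambda>(\<xi>, \<eta>). ?L (- 1) \<xi> \<eta>) p)" for p
        using trivialization_has_log_derivative[OF E, of "-1"] by (cases p) simp
      show "has_log_derivative (\<lambda>p. \<sigma> (?E 1 p)) p ((\<lambda>(\<xi>, \<eta>). ?L (- 1) \<xi> \<eta>) p)" for p
      proof (cases p)
        case (Pair \<xi> \<eta>)
        from has_log_derivative_hom[OF sm(1) UNIV_I
            trivialization_has_log_derivative[OF E zero_neq_one[symmetric]] \<sigma>(2,1)]
        show ?thesis
          unfolding Pair \<sigma>L by simp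
      qed
      show "\<sigma> (?E 1 (0, 0)) = ?E (- 1) (0, 0)" using E0[of 1] E0[of "-1"] by simp
    qed
    then show ?thesis by simp
  qed
  have EU: "E \<xi> \<eta> 1 \<in> U" "E \<xi> \<eta> (- 1) \<in> U" for \<xi> \<eta>
    using Ec \<tau>E assms(10) by (simp_all add: fixed_in_def)
  have s: "s \<xi> \<eta> = E \<xi> \<eta> (- 1) \<otimes>\<^bsub>G\<^esub> inv\<^bsub>G\<^esub> (E \<xi> \<eta> 1)" for \<xi> \<eta> using assms(19) by blast
  have \<sigma>2: "\<sigma> (E \<xi> \<eta> (- 1)) = E \<xi> \<eta> 1" for \<xi> \<eta>
    using \<sigma>E Ec[of 1] assms(6) by (metis lie_involution_def zero_neq_one)
  have M: "s \<xi> \<eta> \<in> M_sigma G U \<sigma>" for \<xi> \<eta>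
    unfolding M_sigma_def using EU(2) \<sigma>2 s by (metis (mono_tags, lifting) mem_Collect_eq)
  have sU: "s \<xi> \<eta> \<in> U" for \<xi> \<eta>
    using Ec \<tau>E unfolding s assms(10) fixed_in_def by simp
  let ?w = "\<lambda>x t. s ((x + t) / 2) ((x - t) / 2)"
  have wave: "wave_map_into G T A c U ?w"
    unfolding wave_map_into_def
  proof (intro conjI allI)
    have "smooth_into_on T A UNIV (\<lambda>p. ?E (- 1) p \<otimes>\<^bsub>G\<^esub> inv\<^bsub>G\<^esub> (?E 1 p))"
      by (intro smooth_mult smooth_inv trivialization_smooth[OF E]) auto
    moreover have "bounded_linear (\<lambda>p::real \<times> real. ((fst p + snd p) / 2, (fst p - snd p) / 2))"
      unfolding linear_conv_bounded_linear[symmetric]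
      by (rule linearI) (auto simp: field_simps)
    ultimately have "smooth_into_on T A UNIV
        (\<lambda>p. (\<lambda>p. ?E (- 1) p \<otimes>\<^bsub>G\<^esub> inv\<^bsub>G\<^esub> (?E 1 p)) ((fst p + snd p) / 2, (fst p - snd p) / 2))"
      by (intro smooth_compose[OF _ open_UNIV smooth_on_bounded_linear]) auto
    then show "smooth_into T A (\<lambda>(x, t). ?w x t)"
      unfolding smooth_into_iff_on by (simp add: s case_prod_unfold)
    show "?w x t \<in> U" for x t by (rule sU)
    show "vector_derivative (\<lambda>t'. left_log_deriv G c (\<lambda>r. ?w x r) t') (at t) =
        vector_derivative (\<lambda>x'. left_log_deriv G c (\<lambda>r. ?w r t) x') (at x)" for x t
      using minus_one_flow_wave_equation[OF flow E, of x t] by (simp add: s)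
  qed
  \<comment> \<open>The map into the coset space is the class of \<open>E\<close> at parameter -1,
    since \<sigma> carries this element to \<open>E\<close> at parameter 1 and the Cartan embedding
    then returns \<open>s\<close>.\<close>
  define f where "f x t = E ((x + t) / 2) ((x - t) / 2) (- 1) <#\<^bsub>G\<^esub> K" for x t
  have "\<one>\<^bsub>G\<^esub> \<in> K" "U \<subseteq> carrier G" using assms(10,13) by (auto simp: fixed_in_def)
  then have cf: "cartan_embedding G \<sigma> (f x t) = ?w x t" for x t
    unfolding f_def using cartan_embedding_coset[OF \<sigma>(1) _ Ec assms(13)] \<sigma>2 s by simp
  have "f x t \<in> coset_space G U K" for x t
    unfolding f_def coset_space_def using EU(2) by blast
  with wave have "wave_map_into_symmetric_space G T A c U K \<sigma> f"
    unfolding wave_map_into_symmetric_space_def cf by simp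
  with cf M wave show ?thesis by blast
qed

end
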